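(* Let $n$ be a positive integer and write $8n+11=3^{\beta}n_1$ with $n_1$ a positive integer and $3\nmid n_1$. Then $$t(1,3,3,4;n)=\sigma(n_1)+a(8n+11).$$
   Context: $\sigma(n)=\sum_{d\mid n,\,d\ge1}d$. The integers $a(n)$ ($n\ge1$) are defined by $q\prod_{k=1}^{\infty}(1-q^{2k})(1-q^{4k})(1-q^{6k})(1-q^{12k})=\sum_{n=1}^{\infty}a(n)q^n$ for $|q|<1$. For positive integers $a,b,c,d$ and a nonnegative integer $n$, $t(a,b,c,d;n)$ denotes the number of $(x,y,z,w)\in\mathbb Z^4$ with $n=a\frac{x(x-1)}2+b\frac{y(y-1)}2+c\frac{z(z-1)}2+d\frac{w(w-1)}2$. *)

theory Defs
  imports "HOL-Complex_Analysis.Complex_Analysis"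
begin

definition divisor_sigma :: "nat \<Rightarrow> nat" where
  "divisor_sigma n = (\<Sum>d | d dvd n. d)"

text \<open>The product of consecutive integers is even, so the integer divisions below are exact.\<close>

definition tri_rep_count :: "nat \<Rightarrow> nat \<Rightarrow> nat \<Rightarrow> nat \<Rightarrow> nat \<Rightarrow> nat" where
  "tri_rep_count a b c d n = card {(x :: int, y :: int, z :: int, w :: int).
     int n = int a * (x * (x - 1) div 2) + int b * (y * (y - 1) div 2)
           + int c * (z * (z - 1) div 2) + int d * (w * (w - 1) div 2)}"

text \<open>
  The \<open>k\<close>-th factor (with \<open>k\<close> starting at \<open>0\<close>) of the eta product, for \<open>q\<close> either a number or
  the formal variable.
\<close>

definition eta_factor :: "'a :: comm_ring_1 \<Rightarrow> nat \<Rightarrow> 'a" where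
  "eta_factor q k = (1 - q ^ (2 * Suc k)) * (1 - q ^ (4 * Suc k))
                  * (1 - q ^ (6 * Suc k)) * (1 - q ^ (12 * Suc k))"

text \<open>
  The infinite product is taken in the ring of formal power series with its usual topology.
  It converges there (\<open>eta_factor_has_prod\<close>), and the resulting integers are the Taylor
  coefficients of the analytic product on the unit disc (\<open>eta_coeff_sums\<close>).
\<close>

definition eta_coeff :: "nat \<Rightarrow> int" where
  "eta_coeff n = fps_nth (fps_X * (\<Prod>k. eta_factor fps_X k)) n"


lemma eta_factor_fps_nth:
  assumes "n < 2 * Suc k"
  shows "fps_nth (eta_factor (fps_X :: 'a :: comm_ring_1 fps) k) n = (if n = 0 then 1 else 0)"
proof -
  have *: "fps_nth (f * (1 - fps_X ^ m)) n = fps_nth f n" if "n < m" for f :: "'a fps" and m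
    using that by (simp add: algebra_simps fps_X_power_mult_right_nth)
  have "fps_nth (eta_factor (fps_X :: 'a fps) k) n = fps_nth (1 - fps_X ^ (2 * Suc k)) n"
    unfolding eta_factor_def using assms by (subst *, simp)+ simp
  also have "\<dots> = (if n = 0 then 1 else 0)"
    using *[of "2 * Suc k" 1] assms by simp
  finally show ?thesis .
qed

lemma eta_partial_prod_stable:
  assumes "n \<le> M" "M \<le> N"
  shows "fps_nth (\<Prod>k<N. eta_factor (fps_X :: 'a :: comm_ring_1 fps) k) n
       = fps_nth (\<Prod>k<M. eta_factor fps_X k) n"
  using assms(2)
proof (induction N rule: dec_induct)
  case base
  show ?case by simp
next
  case (step N)
  have "fps_nth (\<Prod>k<Suc N. eta_factor (fps_X :: 'a fps) k) n
      = (\<Sum>i=0..n. fps_nth (\<Prod>k<N. eta_factor (fps_X :: 'a fps) k) i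
                    * fps_nth (eta_factor fps_X N) (n - i))"
    by (simp add: fps_mult_nth)
  also have "\<dots> = (\<Sum>i=0..n. if i = n then fps_nth (\<Prod>k<N. eta_factor (fps_X :: 'a fps) k) i else 0)"
  proof (rule sum.cong)
    fix i assume "i \<in> {0..n}"
    moreover have "n - i < 2 * Suc N" using assms step by simp
    ultimately show "fps_nth (\<Prod>k<N. eta_factor (fps_X :: 'a fps) k) i
                    * fps_nth (eta_factor fps_X N) (n - i)
        = (if i = n then fps_nth (\<Prod>k<N. eta_factor (fps_X :: 'a fps) k) i else 0)"
      by (subst eta_factor_fps_nth) auto
  qed simp
  also have "\<dots> = fps_nth (\<Prod>k<N. eta_factor (fps_X :: 'a fps) k) n"
    by simp
  finally show ?case using step by simp
qed

lemma eta_factor_has_prod: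
  "(eta_factor (fps_X :: 'a :: idom fps)) has_prod
     Abs_fps (\<lambda>n. fps_nth (\<Prod>k<n. eta_factor fps_X k) n)" (is "_ has_prod ?P")
proof -
  have "(\<lambda>n. \<Prod>k\<le>n. eta_factor (fps_X :: 'a fps) k) \<longlonglongrightarrow> ?P"
  proof (rule tendsto_fpsI)
    fix n
    show "\<forall>\<^sub>F N in sequentially. fps_nth (\<Prod>k\<le>N. eta_factor (fps_X :: 'a fps) k) n = fps_nth ?P n"
      using eventually_ge_at_top[of n]
    proof eventually_elim
      case (elim N)
      thus ?case
        using eta_partial_prod_stable[of n n "Suc N", where 'a = 'a]
        by (simp add: lessThan_Suc_atMost)
    qed
  qed
  moreover have "fps_nth ?P 0 \<noteq> 0" by simp
  hence "?P \<noteq> 0" by (metis fps_zero_nth)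
  ultimately have "raw_has_prod (eta_factor (fps_X :: 'a fps)) 0 ?P"
    by (simp add: raw_has_prod_def)
  thus ?thesis by (simp add: has_prod_def)
qed

lemma eta_coeff_eq_partial:
  assumes "n \<le> N"
  shows "eta_coeff n = fps_nth (fps_X * (\<Prod>k<N. eta_factor fps_X k)) n"
proof -
  have "(\<Prod>k. eta_factor (fps_X :: int fps) k)
      = Abs_fps (\<lambda>n. fps_nth (\<Prod>k<n. eta_factor fps_X k) n)"
    using has_prod_unique[OF eta_factor_has_prod] by metis
  moreover have "fps_nth (\<Prod>k<N. eta_factor (fps_X :: int fps) k) (n - 1)
      = fps_nth (\<Prod>k<n - 1. eta_factor fps_X k) (n - 1)"
    using assms by (intro eta_partial_prod_stable) auto
  ultimately show ?thesis
    by (simp add: eta_coeff_def)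
qed

lemma of_int_eta_partial_prod_nth:
  "of_int (fps_nth (fps_X * (\<Prod>k<N. eta_factor fps_X k)) n)
     = fps_nth (fps_X * (\<Prod>k<N. eta_factor (fps_X :: 'a :: comm_ring_1 fps) k)) n"
proof -
  define h :: "int fps \<Rightarrow> 'a fps" where "h = (\<lambda>f. Abs_fps (\<lambda>n. of_int (fps_nth f n)))"
  have h_mult: "h (f * g) = h f * h g" for f g
    by (rule fps_ext) (simp add: h_def fps_mult_nth)
  have h_diff: "h (f - g) = h f - h g" for f g
    by (rule fps_ext) (simp add: h_def)
  have h_one: "h 1 = 1"
    by (rule fps_ext) (simp add: h_def)
  have h_X: "h fps_X = fps_X"
    by (rule fps_ext) (simp add: h_def fps_X_def)
  have h_pow: "h (f ^ m) = h f ^ m" for f m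
    by (induction m) (simp_all add: h_one h_mult)
  have h_factor: "h (eta_factor fps_X k) = eta_factor fps_X k" for k
    unfolding eta_factor_def h_mult h_diff h_one h_pow h_X ..
  have "h (\<Prod>k<N. eta_factor fps_X k) = (\<Prod>k<N. eta_factor fps_X k)"
    by (induction N) (simp_all add: h_one h_mult h_factor)
  hence "h (fps_X * (\<Prod>k<N. eta_factor fps_X k)) = fps_X * (\<Prod>k<N. eta_factor fps_X k)"
    by (simp add: h_mult h_X)
  from arg_cong[OF this, of "\<lambda>f. fps_nth f n"] show ?thesis
    by (simp add: h_def)
qed

lemma norm_eta_factor_minus_1_le:
  fixes q :: complex
  assumes "norm q \<le> r" "r < 1"
  shows "norm (eta_factor q k - 1) \<le> 15 * r ^ k"
proof -
  have r: "0 \<le> r" using assms norm_ge_zero order_trans by blast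
  have pow: "norm (q ^ m) \<le> r ^ k" if "k \<le> m" for m
  proof -
    have "norm q ^ m \<le> r ^ m" using assms by (intro power_mono) auto
    also have "\<dots> \<le> r ^ k" using assms r that by (intro power_decreasing) auto
    finally show ?thesis by (simp add: norm_power)
  qed
  have rk: "r ^ k \<le> 1" "0 \<le> r ^ k" using assms r by (auto intro: power_le_one)
  have step: "norm (x * (1 - q ^ m) - 1) \<le> 2 * c * r ^ k + r ^ k"
    if "norm (x - 1) \<le> c * r ^ k" "k \<le> m" for x c m
  proof -
    have "x * (1 - q ^ m) - 1 = (x - 1) * (1 - q ^ m) - q ^ m"
      by (simp add: algebra_simps)
    hence "norm (x * (1 - q ^ m) - 1) \<le> norm (x - 1) * norm (1 - q ^ m) + norm (q ^ m)"
      by (metis norm_mult norm_triangle_ineq4)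
    also have "norm (1 - q ^ m) \<le> 2"
      using norm_triangle_ineq4[of 1 "q ^ m"] pow[OF that(2)] rk by simp
    hence "norm (x - 1) * norm (1 - q ^ m) \<le> (c * r ^ k) * 2"
      using that(1) by (intro mult_mono) (auto intro: order_trans[OF norm_ge_zero])
    finally show ?thesis
      using pow[OF that(2)] by simp
  qed
  have "norm ((1 - q ^ (2 * Suc k)) - 1) \<le> 1 * r ^ k"
    using pow[of "2 * Suc k"] by simp
  from step[OF this, of "4 * Suc k"]
  have "norm ((1 - q ^ (2 * Suc k)) * (1 - q ^ (4 * Suc k)) - 1) \<le> 3 * r ^ k" by simp
  from step[OF this, of "6 * Suc k"]
  have "norm ((1 - q ^ (2 * Suc k)) * (1 - q ^ (4 * Suc k)) * (1 - q ^ (6 * Suc k)) - 1)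
      \<le> 7 * r ^ k" by simp
  from step[OF this, of "12 * Suc k"] show ?thesis
    by (simp add: eta_factor_def)
qed

lemma eta_partial_prod_uniform_limit:
  assumes "0 \<le> r" "r < 1"
  shows "uniform_limit (cball (0 :: complex) r) (\<lambda>N q. \<Prod>k<N. eta_factor q k)
           (\<lambda>q. \<Prod>k. eta_factor q k) sequentially"
proof -
  have summ: "summable (\<lambda>k. 15 * r ^ k)"
    using assms by (intro summable_mult summable_geometric) auto
  have "uniformly_convergent_on (cball (0 :: complex) r) (\<lambda>N q. \<Prod>k<N. eta_factor q k)"
  proof (rule uniformly_convergent_on_prod')
    show "continuous_on (cball 0 r) (\<lambda>q :: complex. eta_factor q n)" for n
      unfolding eta_factor_def by (intro continuous_intros)
    show "uniformly_convergent_on (cball (0 :: complex) r) (\<lambda>N q. \<Sum>n<N. norm (eta_factor q n - 1))"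
      by (rule Weierstrass_m_test'[OF _ summ])
         (use assms norm_eta_factor_minus_1_le in \<open>auto simp: dist_norm\<close>)
  qed auto
  hence lim: "uniform_limit (cball (0 :: complex) r) (\<lambda>N q. \<Prod>k<N. eta_factor q k)
                (\<lambda>q. lim (\<lambda>N. \<Prod>k<N. eta_factor q k)) sequentially"
    by (simp add: uniformly_convergent_uniform_limit_iff)
  have "lim (\<lambda>N. \<Prod>k<N. eta_factor q k) = (\<Prod>k. eta_factor q k)"
    if q: "q \<in> cball 0 r" for q :: complex
  proof -
    have "summable (\<lambda>k. norm (eta_factor q k - 1))"
      by (rule summable_comparison_test'[OF summ, of 0])
         (use q assms norm_eta_factor_minus_1_le in \<open>auto simp: dist_norm\<close>)
    hence "abs_convergent_prod (eta_factor q)"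
      by (simp add: abs_convergent_prod_conv_summable)
    hence "convergent_prod (eta_factor q)"
      by (rule abs_convergent_prod_imp_convergent_prod)
    hence "(\<lambda>N. \<Prod>k\<le>N. eta_factor q k) \<longlonglongrightarrow> (\<Prod>k. eta_factor q k)"
      by (rule convergent_prod_LIMSEQ)
    hence "(\<lambda>N. \<Prod>k<Suc N. eta_factor q k) \<longlonglongrightarrow> (\<Prod>k. eta_factor q k)"
      by (simp only: lessThan_Suc_atMost)
    hence "(\<lambda>N. \<Prod>k<N. eta_factor q k) \<longlonglongrightarrow> (\<Prod>k. eta_factor q k)"
      by (rule LIMSEQ_imp_Suc)
    thus ?thesis by (rule limI)
  qed
  with lim show ?thesis
    by (subst (asm) uniform_limit_cong') auto
qed

theorem eta_coeff_sums:
  fixes q :: complex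
  assumes "norm q < 1"
  shows "(\<lambda>n. of_int (eta_coeff (Suc n)) * q ^ Suc n) sums (q * (\<Prod>k. eta_factor q k))"
proof -
  obtain r where r: "norm q < r" "r < 1" using assms dense by blast
  hence r0: "0 < r" by (meson norm_ge_zero order_le_less_trans)
  define f where "f = (\<lambda>N (q :: complex). q * (\<Prod>k<N. eta_factor q k))"
  define g where "g = (\<lambda>q :: complex. q * (\<Prod>k. eta_factor q k))"
  have f_holo: "f N holomorphic_on A" for N A
    unfolding f_def eta_factor_def by (intro holomorphic_intros)
  have "uniform_limit (cball 0 r) f g sequentially"
  proof -
    have ul: "uniform_limit (cball (0 :: complex) r) (\<lambda>N q. \<Prod>k<N. eta_factor q k)
           (\<lambda>q. \<Prod>k. eta_factor q k) sequentially"
      using eta_partial_prod_uniform_limit r r0 by simp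
    have "continuous_on (cball (0 :: complex) r) (\<lambda>q. \<Prod>k. eta_factor q k)"
      by (rule uniform_limit_theorem[OF _ ul])
         (auto intro!: always_eventually continuous_intros simp: eta_factor_def)
    hence "bounded ((\<lambda>q. \<Prod>k. eta_factor q k) ` cball (0 :: complex) r)"
      by (intro compact_imp_bounded compact_continuous_image) auto
    thus ?thesis
      unfolding f_def g_def
      by (intro uniform_lim_mult uniform_limit_const ul) auto
  qed
  hence ul: "uniform_limit (ball 0 r) f g sequentially"
    by (rule uniform_limit_on_subset) auto
  have g_holo: "g holomorphic_on ball 0 r"
  proof (rule holomorphic_uniform_sequence[where f = f])
    fix x :: complex assume "x \<in> ball 0 r"
    then obtain d where "d > 0" "cball x d \<subseteq> ball 0 r"
      by (meson open_ball open_contains_cball)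
    thus "\<exists>d>0. cball x d \<subseteq> ball 0 r \<and> uniform_limit (cball x d) f g sequentially"
      using uniform_limit_on_subset[OF ul] by blast
  qed (use f_holo in auto)
  have coeff: "(deriv ^^ n) g 0 / fact n = of_int (eta_coeff n)" for n
  proof -
    have "(\<lambda>N. (deriv ^^ n) (f N) 0) \<longlonglongrightarrow> (deriv ^^ n) g 0"
      by (rule higher_deriv_complex_uniform_limit[OF ul]) (use r0 f_holo in auto)
    hence "(\<lambda>N. (deriv ^^ n) (f N) 0 / fact n) \<longlonglongrightarrow> (deriv ^^ n) g 0 / fact n"
      by (intro tendsto_intros) auto
    moreover have "(deriv ^^ n) (f N) 0 / fact n = of_int (eta_coeff n)" if "n \<le> N" for N
    proof -
      have "f N has_fps_expansion fps_X * (\<Prod>k<N. eta_factor fps_X k)"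
        unfolding f_def eta_factor_def by (intro fps_expansion_intros)
      hence "(deriv ^^ n) (f N) 0 / fact n = fps_nth (fps_X * (\<Prod>k<N. eta_factor fps_X k)) n"
        by (rule fps_nth_fps_expansion[symmetric])
      thus ?thesis
        using that by (simp only: eta_coeff_eq_partial of_int_eta_partial_prod_nth)
    qed
    hence "(\<lambda>N. (deriv ^^ n) (f N) 0 / fact n) \<longlonglongrightarrow> of_int (eta_coeff n)"
      by (intro tendsto_eventually eventually_sequentiallyI[of n])
    ultimately show ?thesis by (rule LIMSEQ_unique)
  qed
  have "(\<lambda>n. (deriv ^^ n) g 0 / fact n * (q - 0) ^ n) sums g q"
    by (rule holomorphic_power_series[OF g_holo]) (use r in auto)
  hence "(\<lambda>n. of_int (eta_coeff n) * q ^ n) sums g q"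
    by (simp add: coeff)
  moreover have "eta_coeff 0 = 0" by (simp add: eta_coeff_def)
  ultimately show ?thesis
    by (subst sums_Suc_iff) (simp add: g_def)
qed

end

theory Submission
  imports Defs "HOL-Number_Theory.Number_Theory"
begin

text \<open>
  Put \<open>N = 8n + 11\<close>, so \<open>N \<equiv> 3 (mod 8)\<close>, and let \<open>H\<close> be the set of \<open>(a, p, r, c)\<close> with
  \<open>a\<^sup>2 + p\<^sup>2 + 3r\<^sup>2 + 3c\<^sup>2 = N\<close>, \<open>p + r\<close> odd and \<open>a + c\<close> even. Completing squares identifies
  \<open>t(1,3,3,4;n)\<close> with the number of elements of \<open>H\<close> with \<open>c\<close> odd. Let \<open>S\<close> be the rest of \<open>H\<close>, and let
  \<open>U\<close> consist of the elements of \<open>S\<close> with \<open>p \<equiv> 2 (mod 4)\<close>. Three facts give the theorem: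

  \<^item> \<open>|H| = 2\<sigma>(n\<^sub>1)\<close>. The number of representations of an odd \<open>m\<close> by \<open>x\<^sup>2 + 3y\<^sup>2\<close> is
    \<open>2 \<Sum>d|m. \<chi>(d)\<close> with \<open>\<chi>\<close> the character modulo 3, and the convolution of this sum with itself at \<open>2N\<close>
    is evaluated by Liouville's elementary identity.
  \<^item> \<open>t = 2|U|\<close>, by the involution \<open>(a, c) \<mapsto> ((a + 3c)/2, (a - c)/2)\<close>, which preserves \<open>a\<^sup>2 + 3c\<^sup>2\<close>.
  \<^item> \<open>2a(N) = 2|U| - |S|\<close>. With \<open>\<psi>(q) = \<Sum>s\<ge>0. q^(s(s+1)/2)\<close>, the eta product equals
    \<open>q \<psi>(q) \<psi>(-q) \<psi>(q\<^sup>3) \<psi>(-q\<^sup>3)\<close>, so \<open>a(N)\<close> is a signed count of the representations of \<open>8N\<close> by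
    \<open>x\<^sup>2 + y\<^sup>2 + 3z\<^sup>2 + 3w\<^sup>2\<close> in odd numbers; a linear substitution turns it into a signed count over \<open>H\<close>, in
    which the elements with \<open>c\<close> odd cancel.

  Hence \<open>t = 2\<sigma>(n\<^sub>1) - |S| = 2\<sigma>(n\<^sub>1) + 2a(N) - t\<close>.
\<close>

section \<open>Halving sums and cardinalities by involutions\<close>

lemma sum_eq_twice_half:
  fixes g :: "'a \<Rightarrow> 'b :: comm_semiring_1"
  assumes "finite S"
    and f: "\<And>v. v \<in> S \<Longrightarrow> f v \<in> S \<and> f (f v) = v \<and> (Q (f v) \<longleftrightarrow> \<not> Q v) \<and> g (f v) = g v"
  shows "sum g S = 2 * sum g {v \<in> S. Q v}"
proof -
  have "sum g {v \<in> S. \<not> Q v} = sum g {v \<in> S. Q v}"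
    by (rule sum.reindex_bij_witness[where i = f and j = f]) (use f in auto)
  moreover have "sum g S = sum g {v \<in> S. Q v} + sum g {v \<in> S. \<not> Q v}"
    using assms(1) by (subst sum.union_disjoint[symmetric]) (auto intro: sum.cong)
  ultimately show ?thesis by (simp add: mult_2)
qed

lemma card_eq_twice_half:
  assumes "finite S"
    and "\<And>v. v \<in> S \<Longrightarrow> f v \<in> S \<and> f (f v) = v \<and> (Q (f v) \<longleftrightarrow> \<not> Q v)"
  shows "card S = 2 * card {v \<in> S. Q v}"
  using sum_eq_twice_half[of S f Q "\<lambda>_. 1 :: nat"] assms by simp

lemma card_eq_bij_witness:
  assumes "\<And>x. x \<in> A \<Longrightarrow> f x \<in> B \<and> g (f x) = x" "\<And>y. y \<in> B \<Longrightarrow> g y \<in> A \<and> f (g y) = y"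
  shows "card A = card B"
  by (rule bij_betw_same_card, rule bij_betwI[where f = f and g = g]) (use assms in auto)

section \<open>Liouville's identity\<close>

text \<open>For even \<open>M\<close> this records the ways to write \<open>M\<close> as a sum of
  two positive odd numbers \<open>a * d\<close> and \<open>b * e\<close>, together with a chosen
  divisor \<open>d\<close>, \<open>e\<close> of each.\<close>

definition odd_quads :: "nat \<Rightarrow> (nat \<times> nat \<times> nat \<times> nat) set" where
  "odd_quads M = {(a, b, d, e). odd a \<and> odd b \<and> odd d \<and> odd e \<and> a * d + b * e = M}"

lemma finite_odd_quads: "finite (odd_quads M)"
proof (rule finite_subset)
  show "odd_quads M \<subseteq> {..M} \<times> {..M} \<times> {..M} \<times> {..M}"
  proof
    fix v assume "v \<in> odd_quads M"
    then obtain a b d e where v: "v = (a, b, d, e)" "a > 0" "b > 0" "d > 0" "e > 0" "a * d + b * e = M"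
      by (auto simp: odd_quads_def intro: odd_pos)
    then have "a \<le> a * d" "d \<le> a * d" "b \<le> b * e" "e \<le> b * e" by auto
    with v(6) have "a \<le> M" "b \<le> M" "d \<le> M" "e \<le> M" by linarith+
    then show "v \<in> {..M} \<times> {..M} \<times> {..M} \<times> {..M}" by (simp add: v(1))
  qed
qed simp

text \<open>
  In suitable coordinates \<open>(b, c, d, k)\<close> with \<open>bk + cd = M\<close> the two conditions become \<open>b < c\<close> and \<open>d < k\<close>.
  Reducing \<open>d\<close> modulo \<open>k\<close> and moving the quotient into \<open>b\<close> exchanges them; the remainders never
  vanish because \<open>b, d\<close> are odd and \<open>c, k\<close> even.
\<close>

lemma odd_quads_shift:
  fixes f :: "int \<Rightarrow> int"
  shows "(\<Sum>(a, b, d, e)\<in>{v \<in> odd_quads M. case v of (a, b, d, e) \<Rightarrow> d > e}. f (int d - int e)) =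
    (\<Sum>(a, b, d, e)\<in>{v \<in> odd_quads M. case v of (a, b, d, e) \<Rightarrow> a > b}. f (int d + int e))"
proof -
  define W :: "(nat \<times> nat \<times> nat \<times> nat) set"
    where "W = {(b, c, d, k). odd b \<and> odd d \<and> even c \<and> even k \<and> c > 0 \<and> k > 0 \<and> b * k + c * d = M}"
  have "(\<Sum>(a, b, d, e)\<in>{v \<in> odd_quads M. case v of (a, b, d, e) \<Rightarrow> d > e}. f (int d - int e)) =
      (\<Sum>(b, c, d, k)\<in>{v \<in> W. case v of (b, c, d, k) \<Rightarrow> b < c}. f (int k))"
  \<comment> \<open>With \<open>k = d - e\<close> one has
    \<open>a * d + b * e = a * k + (a + b) * e\<close>, so the new coordinates are
    \<open>(a, a + b, e, k)\<close>. The condition \<open>b < c\<close> only says that the old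
    \<open>b\<close> is positive.\<close>
  proof (rule sum.reindex_bij_witness[where j = "\<lambda>(a, b, d, e). (a, a + b, e, d - e)"
          and i = "\<lambda>(b, c, d, k). (b, c - b, d + k, d)"], goal_cases)
    case (2 v)
    obtain a b d e where v: "v = (a, b, d, e)" by (cases v)
    with 2 obtain k where "d = e + k" "k > 0" by (auto dest: less_imp_add_positive)
    then show ?case using 2 by (auto simp: v W_def odd_quads_def algebra_simps odd_pos)
  next
    case (4 v)
    obtain b c d k where v: "v = (b, c, d, k)" by (cases v)
    with 4 obtain l where "c = b + l" "l > 0" by (auto dest: less_imp_add_positive)
    then show ?case using 4 by (auto simp: v W_def odd_quads_def algebra_simps)
  qed (auto simp: of_nat_diff)
  also have "\<dots> = (\<Sum>(b, c, d, k)\<in>{v \<in> W. case v of (b, c, d, k) \<Rightarrow> d < k}. f (int k))"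
  proof (rule sum.reindex_bij_witness[where j = "\<lambda>(b, c, d, k). (b + c * (d div k), c, d mod k, k)"
          and i = "\<lambda>(b, c, d, k). (b mod c, c, d + k * (b div c), k)"], goal_cases)
    case (2 v)
    obtain b c d k where v: "v = (b, c, d, k)" by (cases v)
    have "(b + c * (d div k)) * k + c * (d mod k) = b * k + c * (k * (d div k) + d mod k)"
      by (simp only: algebra_simps)
    then show ?case using 2 by (auto simp: v W_def dvd_mod_iff)
  next
    case (4 v)
    obtain b c d k where v: "v = (b, c, d, k)" by (cases v)
    have "b mod c * k + c * (d + k * (b div c)) = (c * (b div c) + b mod c) * k + c * d"
      by (simp only: algebra_simps)
    then show ?case using 4 by (auto simp: v W_def dvd_mod_iff)
  qed (auto simp: W_def)
  also have "\<dots> = (\<Sum>(a, b, d, e)\<in>{v \<in> odd_quads M. case v of (a, b, d, e) \<Rightarrow> a > b}. f (int d + int e))"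
  \<comment> \<open>This time \<open>k = d + e\<close>, because
    \<open>(b + c) * d + b * (k - d) = b * k + c * d\<close>; the condition \<open>d < k\<close>
    makes \<open>e\<close> positive.\<close>
  proof (rule sum.reindex_bij_witness[where i = "\<lambda>(a, b, d, e). (b, a - b, d, d + e)"
          and j = "\<lambda>(b, c, d, k). (b + c, b, d, k - d)"], goal_cases)
    case (2 v)
    obtain b c d k where v: "v = (b, c, d, k)" by (cases v)
    with 2 obtain l where "k = d + l" "l > 0" by (auto dest: less_imp_add_positive)
    then show ?case using 2 by (auto simp: v W_def odd_quads_def algebra_simps)
  next
    case (4 v)
    obtain a b d e where v: "v = (a, b, d, e)" by (cases v)
    with 4 obtain l where "a = b + l" "l > 0" by (auto dest: less_imp_add_positive)
    then show ?case using 4 by (auto simp: v W_def odd_quads_def algebra_simps odd_pos)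
  qed (auto simp: of_nat_diff)
  finally show ?thesis .
qed

text \<open>For \<open>a = b\<close> the equation is \<open>a * (d + e) = 2 * N\<close>, so
  \<open>d + e = 2 * \<delta>\<close> with \<open>\<delta>\<close> a divisor of \<open>N\<close>.
  Exactly \<open>\<delta>\<close> pairs of positive odd \<open>d\<close>, \<open>e\<close> have this
  sum, whence the weight on the right.\<close>

lemma sum_odd_quads_diag:
  fixes g :: "nat \<Rightarrow> int"
  assumes "odd N"
  shows "(\<Sum>(a, b, d, e)\<in>{v \<in> odd_quads (2 * N). case v of (a, b, d, e) \<Rightarrow> a = b}. g (d + e)) =
    (\<Sum>\<delta> | \<delta> dvd N. int \<delta> * g (2 * \<delta>))"
proof -
  have fin: "finite {\<delta>. \<delta> dvd N}" using assms by (intro finite_divisors_nat) (auto intro: odd_pos)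
  have "(\<Sum>\<delta> | \<delta> dvd N. int \<delta> * g (2 * \<delta>)) = (\<Sum>\<delta> | \<delta> dvd N. \<Sum>i<\<delta>. g (2 * \<delta>))" by simp
  also have "\<dots> = (\<Sum>(\<delta>, i)\<in>(SIGMA \<delta>:{\<delta>. \<delta> dvd N}. {..<\<delta>}). g (2 * \<delta>))"
    using fin by (subst sum.Sigma) auto
  also have "\<dots> = (\<Sum>(a, b, d, e)\<in>{v \<in> odd_quads (2 * N). case v of (a, b, d, e) \<Rightarrow> a = b}. g (d + e))"
  \<comment> \<open>The index \<open>i < \<delta>\<close> stands for the pair
    \<open>d = 2 * i + 1\<close>, \<open>e = 2 * (\<delta> - i) - 1\<close>; the truncated
    subtractions are exact there.\<close>
  proof (rule sum.reindex_bij_witness[where i = "\<lambda>(a, b, d, e). ((d + e) div 2, d div 2)"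
          and j = "\<lambda>(\<delta>, i). (N div \<delta>, N div \<delta>, 2 * i + 1, 2 * (\<delta> - i) - 1)"], goal_cases)
    case (2 v)
    obtain \<delta> i where v: "v = (\<delta>, i)" by (cases v)
    with 2 have "\<delta> dvd N" "i < \<delta>" by auto
    then obtain m where m: "N = \<delta> * m" by blast
    have "odd m" using m assms by auto
    obtain j where j: "\<delta> = Suc (i + j)" using \<open>i < \<delta>\<close> less_natE by blast
    have "N div \<delta> = m" using m \<open>i < \<delta>\<close> by simp
    then show ?case using \<open>i < \<delta>\<close> \<open>odd m\<close> m by (auto simp: v odd_quads_def j algebra_simps)
  next
    case (3 v)
    obtain a d e where v: "v = (a, a, d, e)" "odd a" "odd d" "odd e" "a * d + a * e = 2 * N"
      using 3 by (auto simp: odd_quads_def)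
    obtain i j where ij: "d = 2 * i + 1" "e = 2 * j + 1" using v by (meson oddE)
    have "a * (d + e) = 2 * N" using v by (simp add: algebra_simps)
    then have "2 * N = 2 * (a * (i + j + 1))" by (simp add: ij algebra_simps)
    then have N: "N = a * (i + j + 1)" by simp
    have "N div (i + j + 1) = a" unfolding N by (rule nonzero_mult_div_cancel_right) simp
    then show ?case by (auto simp: v ij)
  next
    case (4 v)
    obtain a d e where v: "v = (a, a, d, e)" "odd a" "odd d" "odd e" "a * d + a * e = 2 * N"
      using 4 by (auto simp: odd_quads_def)
    obtain i j where ij: "d = 2 * i + 1" "e = 2 * j + 1" using v by (meson oddE)
    have "a * (d + e) = 2 * N" using v by (simp add: algebra_simps)
    then have "2 * N = 2 * (a * (i + j + 1))" by (simp add: ij algebra_simps)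
    then have N: "N = a * (i + j + 1)" by simp
    have "i + j + 1 dvd N" unfolding N by (rule dvd_triv_right)
    then show ?case by (auto simp: v ij)
  qed (auto intro!: arg_cong[where f = g])
  finally show ?thesis ..
qed

text \<open>The first sum is split at \<open>d = e\<close> and the second at \<open>a = b\<close>.
  By symmetry each off-diagonal part is twice its half, the halves agree by
  \<open>odd_quads_shift\<close>, and only the diagonals survive the subtraction.\<close>

theorem liouville_odd_quads:
  fixes f :: "int \<Rightarrow> int"
  assumes "odd N" and even: "\<And>x. f (- x) = f x"
  shows "(\<Sum>(a, b, d, e)\<in>odd_quads (2 * N). f (int d - int e) - f (int d + int e)) =
    (\<Sum>\<delta> | \<delta> dvd N. int \<delta> * (f 0 - f (2 * int \<delta>)))"
proof -
  let ?Q = "odd_quads (2 * N)"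
  have split: "sum g ?Q = sum g {v \<in> ?Q. P v} + sum g {v \<in> ?Q. \<not> P v}" for g :: "_ \<Rightarrow> int" and P
    using finite_odd_quads[of "2 * N"] by (subst sum.union_disjoint[symmetric]) (auto intro: sum.cong)
  have minus: "(\<Sum>(a, b, d, e)\<in>?Q. f (int d - int e)) = (\<Sum>\<delta> | \<delta> dvd N. int \<delta> * f 0) +
     2 * (\<Sum>(a, b, d, e)\<in>{v \<in> ?Q. case v of (a, b, d, e) \<Rightarrow> d > e}. f (int d - int e))"
  proof -
    \<comment> \<open>Exchanging \<open>(a, b)\<close> with \<open>(d, e)\<close> turns the diagonal
      \<open>d = e\<close> into \<open>a = b\<close>, where \<open>sum_odd_quads_diag\<close>
      applies.\<close>
    have "(\<Sum>(a, b, d, e)\<in>{v \<in> ?Q. case v of (a, b, d, e) \<Rightarrow> d = e}. f (int d - int e)) =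
        (\<Sum>(a, b, d, e)\<in>{v \<in> ?Q. case v of (a, b, d, e) \<Rightarrow> a = b}. f 0)"
      by (rule sum.reindex_bij_witness[where i = "\<lambda>(a, b, d, e). (d, e, a, b)"
            and j = "\<lambda>(a, b, d, e). (d, e, a, b)"]) (auto simp: odd_quads_def algebra_simps)
    also have "\<dots> = (\<Sum>\<delta> | \<delta> dvd N. int \<delta> * f 0)"
      using sum_odd_quads_diag[OF assms(1), of "\<lambda>_. f 0"] .
    finally have diag: "(\<Sum>(a, b, d, e)\<in>{v \<in> ?Q. case v of (a, b, d, e) \<Rightarrow> d = e}. f (int d - int e)) =
      (\<Sum>\<delta> | \<delta> dvd N. int \<delta> * f 0)" .
    \<comment> \<open>Swapping the two products changes the sign of \<open>d - e\<close>, which the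
      even function \<open>f\<close> does not see.\<close>
    have "(\<Sum>(a, b, d, e)\<in>{v \<in> ?Q. \<not> (case v of (a, b, d, e) \<Rightarrow> d = e)}. f (int d - int e)) =
       2 * (\<Sum>(a, b, d, e)\<in>{v \<in> {v \<in> ?Q. \<not> (case v of (a, b, d, e) \<Rightarrow> d = e)}.
              case v of (a, b, d, e) \<Rightarrow> d > e}. f (int d - int e))"
      by (rule sum_eq_twice_half[where f = "\<lambda>(a, b, d, e). (b, a, e, d)"])
        (use finite_odd_quads even[of "int _ - int _"] in \<open>auto simp: odd_quads_def add.commute\<close>)
    also have "{v \<in> {v \<in> ?Q. \<not> (case v of (a, b, d, e) \<Rightarrow> d = e)}.
        case v of (a, b, d, e) \<Rightarrow> d > e} = {v \<in> ?Q. case v of (a, b, d, e) \<Rightarrow> d > e}" by auto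
    finally show ?thesis using split[of "\<lambda>(a, b, d, e). f (int d - int e)" "\<lambda>(a, b, d, e). d = e"] diag
      by linarith
  qed
  have plus: "(\<Sum>(a, b, d, e)\<in>?Q. f (int d + int e)) = (\<Sum>\<delta> | \<delta> dvd N. int \<delta> * f (2 * int \<delta>)) +
     2 * (\<Sum>(a, b, d, e)\<in>{v \<in> ?Q. case v of (a, b, d, e) \<Rightarrow> a > b}. f (int d + int e))"
  proof -
    have diag: "(\<Sum>(a, b, d, e)\<in>{v \<in> ?Q. case v of (a, b, d, e) \<Rightarrow> a = b}. f (int d + int e)) =
       (\<Sum>\<delta> | \<delta> dvd N. int \<delta> * f (2 * int \<delta>))"
      using sum_odd_quads_diag[OF assms(1), of "\<lambda>k. f (int k)"] by simp
    have "(\<Sum>(a, b, d, e)\<in>{v \<in> ?Q. \<not> (case v of (a, b, d, e) \<Rightarrow> a = b)}. f (int d + int e)) =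
       2 * (\<Sum>(a, b, d, e)\<in>{v \<in> {v \<in> ?Q. \<not> (case v of (a, b, d, e) \<Rightarrow> a = b)}.
              case v of (a, b, d, e) \<Rightarrow> a > b}. f (int d + int e))"
      by (rule sum_eq_twice_half[where f = "\<lambda>(a, b, d, e). (b, a, e, d)"])
        (use finite_odd_quads in \<open>auto simp: odd_quads_def add.commute\<close>)
    also have "{v \<in> {v \<in> ?Q. \<not> (case v of (a, b, d, e) \<Rightarrow> a = b)}.
        case v of (a, b, d, e) \<Rightarrow> a > b} = {v \<in> ?Q. case v of (a, b, d, e) \<Rightarrow> a > b}" by auto
    finally show ?thesis using split[of "\<lambda>(a, b, d, e). f (int d + int e)" "\<lambda>(a, b, d, e). a = b"] diag
      by linarith
  qed
  have "(\<Sum>(a, b, d, e)\<in>?Q. f (int d - int e) - f (int d + int e)) =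
     (\<Sum>(a, b, d, e)\<in>?Q. f (int d - int e)) - (\<Sum>(a, b, d, e)\<in>?Q. f (int d + int e))"
    by (simp add: sum_subtractf[symmetric] case_prod_unfold)
  also have "\<dots> = (\<Sum>\<delta> | \<delta> dvd N. int \<delta> * f 0) - (\<Sum>\<delta> | \<delta> dvd N. int \<delta> * f (2 * int \<delta>))"
    unfolding minus plus odd_quads_shift by simp
  also have "\<dots> = (\<Sum>\<delta> | \<delta> dvd N. int \<delta> * (f 0 - f (2 * int \<delta>)))"
    by (simp add: sum_subtractf[symmetric] algebra_simps)
  finally show ?thesis .
qed

section \<open>Representations by \<open>x\<^sup>2 + 3y\<^sup>2\<close>\<close>

definition chi3 :: "nat \<Rightarrow> int" where
  "chi3 d = (if d mod 3 = 1 then 1 else if d mod 3 = 2 then -1 else 0)"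

lemma chi3_mult: "chi3 (a * b) = chi3 a * chi3 b"
proof -
  have "a mod 3 = 0 \<or> a mod 3 = 1 \<or> a mod 3 = 2" "b mod 3 = 0 \<or> b mod 3 = 1 \<or> b mod 3 = 2" by auto
  moreover have "(a * b) mod 3 = (a mod 3) * (b mod 3) mod 3" by (simp add: mod_mult_eq)
  ultimately show ?thesis by (elim disjE) (simp_all add: chi3_def)
qed

text \<open>The divisors of \<open>p * m\<close> are those of \<open>m\<close> and their multiples
  by \<open>p\<close>; the subtracted term corrects for the overlap. For odd \<open>p\<close>,
  \<open>card_rep3_prime_mult\<close> has the same recursion.\<close>

lemma sum_chi3_prime_mult:
  assumes "prime p" "m > 0"
  shows "(\<Sum>d | d dvd p * m. chi3 d) = (1 + chi3 p) * (\<Sum>d | d dvd m. chi3 d)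
    - (if p dvd m then chi3 p * (\<Sum>d | d dvd m div p. chi3 d) else 0)"
proof -
  have p: "p > 0" using assms(1) by (simp add: prime_gt_0_nat)
  define A where "A = {d. d dvd m}"
  define B where "B = (\<lambda>d. p * d) ` A"
  have fin: "finite A" "finite B" using assms(2) by (auto simp: A_def B_def)
  have AB: "{d. d dvd p * m} = A \<union> B"
  proof (intro equalityI subsetI)
    fix d assume "d \<in> {d. d dvd p * m}"
    then have d: "d dvd p * m" by simp
    show "d \<in> A \<union> B"
    proof (cases "p dvd d")
      case True
      then obtain e where "d = p * e" by blast
      then show ?thesis using d p by (auto simp: A_def B_def)
    next
      case False
      then have "coprime d p" using assms(1) prime_imp_coprime coprime_commute by blast
      then have "d dvd m" using d by (simp add: coprime_dvd_mult_right_iff)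
      then show ?thesis by (simp add: A_def)
    qed
  qed (auto simp: A_def B_def)
  have sumB: "sum chi3 ((\<lambda>d. p * d) ` C) = chi3 p * sum chi3 C" for C
    using p by (subst sum.reindex) (auto simp: inj_on_def chi3_mult sum_distrib_left)
  have "A \<inter> B = (\<lambda>d. p * d) ` {d. p * d dvd m}"
    unfolding A_def B_def by (auto dest: dvd_mult_right)
  moreover have "{d. p * d dvd m} = (if p dvd m then {d. d dvd m div p} else {})"
    using p by (auto simp: dvd_div_iff_mult mult.commute dest: dvd_mult_left)
  ultimately have "sum chi3 (A \<inter> B) = (if p dvd m then chi3 p * (\<Sum>d | d dvd m div p. chi3 d) else 0)"
    using sumB by (simp split: if_splits)
  moreover have "sum chi3 (A \<union> B) + sum chi3 (A \<inter> B) = sum chi3 A + sum chi3 B"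
    using fin by (rule sum.union_inter)
  ultimately show ?thesis
    using sumB[of A] unfolding AB A_def[symmetric] B_def[symmetric] by (simp add: algebra_simps)
qed

section \<open>How the number of representations changes when a prime factor is added\<close>

definition rep3 :: "nat \<Rightarrow> (int \<times> int) set" where
  "rep3 n = {(x, y). x\<^sup>2 + 3 * y\<^sup>2 = int n}"

lemma abs_le_square: "\<bar>x\<bar> \<le> x\<^sup>2" for x :: int
proof (cases "x = 0")
  case False
  then have "\<bar>x\<bar> * 1 \<le> \<bar>x\<bar> * \<bar>x\<bar>" by (intro mult_left_mono) auto
  then show ?thesis by (simp add: power2_eq_square)
qed simp

lemma finite_rep3: "finite (rep3 n)"
proof (rule finite_subset)
  show "rep3 n \<subseteq> {- int n..int n} \<times> {- int n..int n}"
  proof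
    fix v assume "v \<in> rep3 n"
    then obtain x y where v: "v = (x, y)" "x\<^sup>2 + 3 * y\<^sup>2 = int n" by (auto simp: rep3_def)
    have "\<bar>x\<bar> \<le> int n" "\<bar>y\<bar> \<le> int n"
      using abs_le_square[of x] abs_le_square[of y] v(2) zero_le_power2[of x] zero_le_power2[of y] by linarith+
    then show "v \<in> {- int n..int n} \<times> {- int n..int n}" by (auto simp: v)
  qed
qed simp

text \<open>A residue of order 3 yields a square root \<open>h\<close> of -3 modulo
  \<open>p\<close>. Thue's argument then gives small \<open>u\<close>, \<open>v\<close>, not both
  zero, with \<open>u = h * v\<close> modulo \<open>p\<close>, so u^2 + 3 v^2 is a multiple of
  \<open>p\<close> strictly between 0 and \<open>4 * p\<close>.\<close>

lemma prime_eq_square_plus_3_square: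
  assumes "prime p" "p mod 3 = 1"
  shows "\<exists>a b :: int. int p = a\<^sup>2 + 3 * b\<^sup>2"
proof -
  have p4: "p \<ge> 4" using assms prime_ge_2_nat[of p] by (cases "p = 2 \<or> p = 3") auto
  have p_int: "prime (int p)" using assms(1) by simp
  have "3 dvd p - 1" using assms(2) by presburger
  obtain x where x: "ord p x = 3"
  proof -
    have "card {x\<in>totatives p. ord p x = 3} = totient 3"
      using prime_card_elements_with_ord_eq_totient[of p 3] assms(1) p4 \<open>3 dvd p - 1\<close> by simp
    then have "card {x\<in>totatives p. ord p x = 3} \<noteq> 0" by simp
    then have "{x\<in>totatives p. ord p x = 3} \<noteq> {}" by (metis card.empty)
    then show ?thesis using that by blast
  qed
  have "[x ^ 3 = 1] (mod p)" using ord[of x p] x by simp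
  then have "int p dvd int x ^ 3 - 1"
    by (metis cong_iff_dvd_diff cong_int_iff of_nat_1 of_nat_power)
  moreover have "int x ^ 3 - 1 = (int x - 1) * ((int x)\<^sup>2 + int x + 1)"
    by (simp add: algebra_simps power2_eq_square power3_eq_cube)
  ultimately have "int p dvd int x - 1 \<or> int p dvd (int x)\<^sup>2 + int x + 1"
    using p_int prime_dvd_mult_iff by metis
  moreover have "\<not> int p dvd int x - 1"
  proof
    assume "int p dvd int x - 1"
    then have "[x = 1] (mod p)" by (metis cong_iff_dvd_diff cong_int_iff of_nat_1)
    then have "[x ^ 1 = 1] (mod p)" by simp
    then have "3 dvd (1 :: nat)" using x ord_divides by metis
    then show False by simp
  qed
  ultimately have "int p dvd 4 * ((int x)\<^sup>2 + int x + 1)" by (meson dvd_mult)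
  \<comment> \<open>Completing the square: 4 (x^2 + x + 1) = (2 x + 1)^2 + 3.\<close>
  moreover define h where "h = 2 * int x + 1"
  ultimately have h: "int p dvd h\<^sup>2 + 3"
    by (simp add: algebra_simps power2_eq_square)
  define k where "k = nat \<lfloor>sqrt (real p)\<rfloor>"
  have k: "k\<^sup>2 \<le> p" "p < (k + 1)\<^sup>2"
  proof -
    have "real k \<le> sqrt p" "sqrt p < real k + 1" by (simp_all add: k_def)
    then have "(real k)\<^sup>2 \<le> (sqrt p)\<^sup>2" "(sqrt p)\<^sup>2 < (real k + 1)\<^sup>2"
      by (intro power_mono power_strict_mono; simp)+
    then have "real (k\<^sup>2) \<le> real p" "real p < real ((k + 1)\<^sup>2)" by (simp_all add: add.commute)
    then show "k\<^sup>2 \<le> p" "p < (k + 1)\<^sup>2" by linarith+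
  qed
  \<comment> \<open>A prime is not a square, which makes the bounds u^2 < p and v^2 < p strict and
    so excludes the multiple \<open>4 * p\<close>.\<close>
  have nsq: "int p \<noteq> z\<^sup>2" for z
  proof
    assume "int p = z\<^sup>2"
    then have "p = nat \<bar>z\<bar> * nat \<bar>z\<bar>" by (metis abs_power2 nat_abs_mult_distrib nat_int power2_eq_square abs_of_nat)
    then show False using assms(1) prime_product[of "nat \<bar>z\<bar>" "nat \<bar>z\<bar>"] by auto
  qed
  \<comment> \<open>Thue: there are more than \<open>p\<close> pairs \<open>(i, j)\<close>, so two of them agree modulo \<open>p\<close>.\<close>
  define \<phi> where "\<phi> = (\<lambda>(i, j). (i - h * j) mod int p)"
  have "\<not> inj_on \<phi> ({0..int k} \<times> {0..int k})"
  proof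
    assume "inj_on \<phi> ({0..int k} \<times> {0..int k})"
    moreover have "\<phi> ` ({0..int k} \<times> {0..int k}) \<subseteq> {0..<int p}" using p4 by (auto simp: \<phi>_def)
    ultimately have "card ({0..int k} \<times> {0..int k}) \<le> card {0..<int p}" by (intro card_inj_on_le) auto
    moreover have "nat (int k + 1) = k + 1" by simp
    ultimately show False using k by (simp add: power2_eq_square card_cartesian_product)
  qed
  then obtain i j i' j' where ij: "0 \<le> i" "i \<le> int k" "0 \<le> j" "j \<le> int k" "0 \<le> i'" "i' \<le> int k"
    "0 \<le> j'" "j' \<le> int k" "(i, j) \<noteq> (i', j')" "(i - h * j) mod int p = (i' - h * j') mod int p"
    unfolding inj_on_def \<phi>_def by auto
  define u v where "u = i - i'" "v = j - j'"
  have uv0: "u \<noteq> 0 \<or> v \<noteq> 0" using ij by (auto simp: u_v_def)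
  have "\<bar>u\<bar> \<le> int k" "\<bar>v\<bar> \<le> int k" using ij by (auto simp: u_v_def)
  then have "u\<^sup>2 \<le> (int k)\<^sup>2" "v\<^sup>2 \<le> (int k)\<^sup>2" by (auto simp: abs_le_square_iff[symmetric])
  moreover have "(int k)\<^sup>2 \<le> int p" using k(1) by (metis of_nat_le_iff of_nat_power)
  ultimately have "u\<^sup>2 < int p" "v\<^sup>2 < int p" using nsq[of u] nsq[of v] by linarith+
  moreover have "u\<^sup>2 + 3 * v\<^sup>2 > 0" using uv0 zero_less_power2[of u] zero_less_power2[of v]
    zero_le_power2[of u] zero_le_power2[of v] by (elim disjE) linarith+
  moreover have "int p dvd u\<^sup>2 + 3 * v\<^sup>2"
  proof -
    have "int p dvd (i - h * j) - (i' - h * j')" using ij(10) by (simp add: mod_eq_dvd_iff)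
    then have "int p dvd u - h * v" by (simp add: u_v_def algebra_simps)
    then have "int p dvd (u - h * v) * (u + h * v) + (h\<^sup>2 + 3) * v\<^sup>2" using h by simp
    then show ?thesis by (simp add: algebra_simps power2_eq_square)
  qed
  then obtain c where c: "u\<^sup>2 + 3 * v\<^sup>2 = int p * c" by blast
  ultimately have "0 < int p * c" "int p * c < int p * 4" by linarith+
  then have "0 < c" "c < 4" using p4 by (auto simp: zero_less_mult_iff)
  \<comment> \<open>The value 2 is impossible modulo 4. For the value 3, \<open>u\<close> is a
    multiple of 3, and dividing by 3 exchanges the roles of the two squares.\<close>
  then consider "c = 1" | "c = 2" | "c = 3" by linarith
  then show ?thesis
  proof cases
    case 1
    then have "int p = u\<^sup>2 + 3 * v\<^sup>2" using c by simp
    then show ?thesis by blast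
  next
    case 2
    have "odd p" using assms(1) p4 prime_odd_nat by auto
    then have "odd (int p)" by simp
    then have "(u\<^sup>2 + 3 * v\<^sup>2) mod 4 = 2" using 2 c by presburger
    moreover have "z\<^sup>2 mod 4 = 0 \<or> z\<^sup>2 mod 4 = 1" for z :: int
    proof -
      have "z mod 4 = 0 \<or> z mod 4 = 1 \<or> z mod 4 = 2 \<or> z mod 4 = 3" by presburger
      moreover have "z\<^sup>2 mod 4 = (z mod 4)\<^sup>2 mod 4" by (simp add: power_mod)
      ultimately show ?thesis by (elim disjE) simp_all
    qed
    from this[of u] this[of v] have "(u\<^sup>2 + 3 * v\<^sup>2) mod 4 \<noteq> 2" by presburger
    ultimately show ?thesis by simp
  next
    case 3
    then have "3 dvd u\<^sup>2" using c by presburger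
    then have "3 dvd u" using prime_dvd_power[of "3 :: int"] by simp
    then obtain w where w: "u = 3 * w" by blast
    have "int p = v\<^sup>2 + 3 * w\<^sup>2" using c 3 by (simp add: w power_mult_distrib)
    then show ?thesis by blast
  qed
qed

text \<open>Removing a common factor \<open>p\<close> from both coordinates divides the form by p^2.
  These representations form the overlap for a split prime and the whole set for an inert
  one.\<close>

lemma card_rep3_both_dvd:
  assumes "prime p"
  shows "card {(x, y) \<in> rep3 (p * m). int p dvd x \<and> int p dvd y} =
    (if p dvd m then card (rep3 (m div p)) else 0)"
proof -
  have p: "p > 0" using assms by (simp add: prime_gt_0_nat)
  have eq: "(int p * u)\<^sup>2 + 3 * (int p * v)\<^sup>2 = int (p * m) \<longleftrightarrow> int p * (u\<^sup>2 + 3 * v\<^sup>2) = int m" for u v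
  proof -
    have "(int p * u)\<^sup>2 + 3 * (int p * v)\<^sup>2 = int p * (int p * (u\<^sup>2 + 3 * v\<^sup>2))"
      by (simp add: power2_eq_square algebra_simps)
    then show ?thesis using p by simp
  qed
  show ?thesis
  proof (cases "p dvd m")
    case True
    then obtain l where l: "m = p * l" by blast
    have "card (rep3 l) = card {(x, y) \<in> rep3 (p * m). int p dvd x \<and> int p dvd y}"
    proof (rule card_eq_bij_witness[where f = "\<lambda>(x, y). (int p * x, int p * y)"
          and g = "\<lambda>(x, y). (x div int p, y div int p)"])
      fix v assume "v \<in> rep3 l"
      then obtain u w where v: "v = (u, w)" "u\<^sup>2 + 3 * w\<^sup>2 = int l" by (auto simp: rep3_def)
      then have "(int p * u)\<^sup>2 + 3 * (int p * w)\<^sup>2 = int (p * m)" by (subst eq) (simp add: l)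
      then show "(case v of (x, y) \<Rightarrow> (int p * x, int p * y)) \<in>
          {(x, y) \<in> rep3 (p * m). int p dvd x \<and> int p dvd y} \<and>
        (case (case v of (x, y) \<Rightarrow> (int p * x, int p * y)) of (x, y) \<Rightarrow> (x div int p, y div int p)) = v"
        using p v by (simp add: rep3_def)
    next
      fix v assume "v \<in> {(x, y) \<in> rep3 (p * m). int p dvd x \<and> int p dvd y}"
      then obtain u w where v: "v = (int p * u, int p * w)" "(int p * u)\<^sup>2 + 3 * (int p * w)\<^sup>2 = int (p * m)"
        by (auto simp: rep3_def elim!: dvdE)
      from v(2) have "u\<^sup>2 + 3 * w\<^sup>2 = int l" using p by (subst (asm) eq) (simp add: l)
      then show "(case v of (x, y) \<Rightarrow> (x div int p, y div int p)) \<in> rep3 l \<and>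
        (case (case v of (x, y) \<Rightarrow> (x div int p, y div int p)) of (x, y) \<Rightarrow> (int p * x, int p * y)) = v"
        using p v by (simp add: rep3_def)
    qed
    then show ?thesis using p by (simp add: l)
  next
    case False
    then have "int p * z \<noteq> int m" for z by (metis dvd_triv_left int_dvd_int_iff)
    then have "{(x, y) \<in> rep3 (p * m). int p dvd x \<and> int p dvd y} = {}"
      using eq by (auto simp: rep3_def elim!: dvdE simp del: of_nat_mult)
    then show ?thesis using False by (simp only: card.empty if_False)
  qed
qed

text \<open>The bijection is multiplication by \<open>a + b\<surd>(-3)\<close>, an element of norm \<open>p\<close>.\<close>

lemma card_rep3_dvd_twist:
  fixes a b :: int
  assumes "prime p" and p: "int p = a\<^sup>2 + 3 * b\<^sup>2"
  shows "card {(x, y) \<in> rep3 (p * m). int p dvd x * b - y * a} = card (rep3 m)"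
proof -
  have p0: "p > 0" using assms by (simp add: prime_gt_0_nat)
  have norm: "(u * a - 3 * v * b)\<^sup>2 + 3 * (u * b + v * a)\<^sup>2 = int p * (u\<^sup>2 + 3 * v\<^sup>2)" for u v
    unfolding p by (simp add: power2_eq_square algebra_simps)
  have "card (rep3 m) = card {(x, y) \<in> rep3 (p * m). int p dvd x * b - y * a}"
  \<comment> \<open>The inverse is multiplication by the conjugate of a + b sqrt(-3), followed by
    division by the norm \<open>p\<close>.\<close>
  proof (rule card_eq_bij_witness[where f = "\<lambda>(u, v). (u * a - 3 * v * b, u * b + v * a)"
        and g = "\<lambda>(x, y). ((x * a + 3 * y * b) div int p, (y * a - x * b) div int p)"])
    fix w assume "w \<in> rep3 m"
    moreover have "(u * a - 3 * v * b) * b - (u * b + v * a) * a = - (v * int p)"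
      "(u * a - 3 * v * b) * a + 3 * (u * b + v * a) * b = u * int p"
      "(u * b + v * a) * a - (u * a - 3 * v * b) * b = v * int p" for u v
      unfolding p by (simp_all add: power2_eq_square algebra_simps)
    ultimately show "(case w of (u, v) \<Rightarrow> (u * a - 3 * v * b, u * b + v * a)) \<in>
        {(x, y) \<in> rep3 (p * m). int p dvd x * b - y * a} \<and>
      (case (case w of (u, v) \<Rightarrow> (u * a - 3 * v * b, u * b + v * a)) of
        (x, y) \<Rightarrow> ((x * a + 3 * y * b) div int p, (y * a - x * b) div int p)) = w"
      using p0 by (cases w) (simp add: rep3_def norm del: distrib_right_numeral distrib_left_numeral)
  next
    fix w assume w: "w \<in> {(x, y) \<in> rep3 (p * m). int p dvd x * b - y * a}"
    obtain x y where xy: "w = (x, y)" by (cases w)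
    have n: "x\<^sup>2 + 3 * y\<^sup>2 = int p * int m" and "int p dvd x * b - y * a" using w by (auto simp: xy rep3_def)
    then obtain v where v: "y * a - x * b = int p * v" by (metis dvd_diff_commute dvdE)
    \<comment> \<open>The hypothesis makes only one coordinate of the quotient integral.
      Multiplicativity of the norm shows that p^2 divides the square of the other numerator, so that
      division is exact too.\<close>
    have "(x * a + 3 * y * b)\<^sup>2 + 3 * (y * a - x * b)\<^sup>2 = int p * (x\<^sup>2 + 3 * y\<^sup>2)"
      unfolding p by (simp add: power2_eq_square algebra_simps)
    then have sq: "(x * a + 3 * y * b)\<^sup>2 + 3 * (int p * v)\<^sup>2 = (int p)\<^sup>2 * int m"
      unfolding v n by (simp only: power2_eq_square mult.assoc)
    then have "(x * a + 3 * y * b)\<^sup>2 = (int p)\<^sup>2 * (int m - 3 * v\<^sup>2)"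
      by (simp add: power_mult_distrib algebra_simps)
    then have "int p ^ 2 dvd (x * a + 3 * y * b)\<^sup>2" by simp
    then have "int p dvd x * a + 3 * y * b" by simp
    then obtain u where u: "x * a + 3 * y * b = int p * u" by blast
    have "(int p)\<^sup>2 * (u\<^sup>2 + 3 * v\<^sup>2) = (int p)\<^sup>2 * int m"
      using sq unfolding u by (simp add: power_mult_distrib algebra_simps)
    then have uv: "u\<^sup>2 + 3 * v\<^sup>2 = int m" using p0 by simp
    have g: "(case w of (x, y) \<Rightarrow> ((x * a + 3 * y * b) div int p, (y * a - x * b) div int p)) = (u, v)"
      using p0 by (simp add: xy u v)
    have "int p * (u * a - 3 * v * b) = int p * x"
      using arg_cong[OF u, of "\<lambda>t. t * a"] arg_cong[OF v, of "\<lambda>t. t * b"] p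
      by (simp add: algebra_simps power2_eq_square)
    moreover have "int p * (u * b + v * a) = int p * y"
      using arg_cong[OF u, of "\<lambda>t. t * b"] arg_cong[OF v, of "\<lambda>t. t * a"] p
      by (simp add: algebra_simps power2_eq_square)
    ultimately show "(case w of (x, y) \<Rightarrow> ((x * a + 3 * y * b) div int p, (y * a - x * b) div int p)) \<in> rep3 m \<and>
      (case (case w of (x, y) \<Rightarrow> ((x * a + 3 * y * b) div int p, (y * a - x * b) div int p)) of
        (u, v) \<Rightarrow> (u * a - 3 * v * b, u * b + v * a)) = w"
      unfolding g using p0 uv by (simp add: xy rep3_def)
  qed
  then show ?thesis ..
qed

text \<open>For such \<open>p\<close>, -3 is not a square modulo \<open>p\<close>: a square root
  would give a nontrivial cube root of unity, although 3 does not divide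
  \<open>p - 1\<close>.\<close>

lemma inert_prime_dvd:
  fixes x y :: int
  assumes p: "prime p" "odd p" "p mod 3 = 2" and dvd: "int p dvd x\<^sup>2 + 3 * y\<^sup>2"
  shows "int p dvd x \<and> int p dvd y"
proof -
  have p_int: "prime (int p)" using p by simp
  have "int p dvd y"
  proof (rule ccontr)
    assume y: "\<not> int p dvd y"
    \<comment> \<open>\<open>\<alpha>\<^sup>3 \<equiv> \<beta>\<^sup>3\<close>, and cubing is injective modulo \<open>p\<close> because \<open>3\<close> does not divide \<open>p - 1\<close>.\<close>
    define \<alpha> \<beta> where "\<alpha> = x - y" "\<beta> = 2 * y"
    have two: "\<not> int p dvd 2"
      using p primes_dvd_imp_eq[of p 2] by (metis even_numeral int_dvd_int_iff of_nat_numeral two_is_prime_nat)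
    have three: "\<not> int p dvd 3"
    proof
      assume "int p dvd 3"
      then have "p dvd 3" by presburger
      then have "p = 3" using p(1) primes_dvd_imp_eq[of p 3] by simp
      then show False using p(3) by simp
    qed
    have \<beta>: "\<not> int p dvd \<beta>" using y two p_int by (simp add: \<alpha>_\<beta>_def prime_dvd_mult_iff)
    \<comment> \<open>The choice of \<open>\<alpha>\<close> and \<open>\<beta>\<close> makes
      \<alpha>^2 + \<alpha> \<beta> + \<beta>^2 equal to x^2 + 3 y^2.\<close>
    have "\<alpha> ^ 3 - \<beta> ^ 3 = (\<alpha> - \<beta>) * (x\<^sup>2 + 3 * y\<^sup>2)"
      by (simp add: \<alpha>_\<beta>_def algebra_simps power2_eq_square power3_eq_cube)
    then have "int p dvd \<alpha> ^ 3 - \<beta> ^ 3" using dvd by simp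
    then have cube: "[\<alpha> ^ 3 = \<beta> ^ 3] (mod int p)" by (simp add: cong_iff_dvd_diff)
    have \<alpha>: "\<not> int p dvd \<alpha>"
    proof
      assume "int p dvd \<alpha>"
      then have "int p dvd \<alpha> ^ 3" by (simp add: power3_eq_cube)
      then have "int p dvd \<beta> ^ 3" using cube cong_dvd_iff cong_sym by blast
      then show False using \<beta> p_int prime_dvd_power by blast
    qed
    define k where "k = p div 3"
    have pk: "p - 1 = 3 * k + 1" using p(3) by (simp add: k_def) presburger
    have fermat: "[z ^ (3 * k + 1) = 1] (mod int p)" if "\<not> int p dvd z" for z :: int
    proof -
      have "coprime z (int p)" using that p_int prime_imp_coprime coprime_commute by blast
      moreover have "residues (int p)" using prime_gt_1_nat[OF p(1)] by (simp add: residues_def)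
      ultimately have "[z ^ totient (nat (int p)) = 1] (mod int p)"
        using residues.euler_theorem by blast
      then show ?thesis using totient_prime[OF p(1)] pk by simp
    qed
    \<comment> \<open>The inverses of \<open>\<alpha>\<close> and \<open>\<beta>\<close> modulo
      \<open>p\<close> are their powers with exponent \<open>3 * k\<close>, and these agree because
      the cubes do.\<close>
    have "[\<alpha> * \<beta> ^ (3 * k) = \<alpha> * \<alpha> ^ (3 * k)] (mod int p)"
      using cong_pow[OF cong_sym[OF cube], of k] by (intro cong_mult cong_refl) (simp add: power_mult)
    also have "[\<alpha> * \<alpha> ^ (3 * k) = 1] (mod int p)" using fermat[OF \<alpha>] by simp
    also have "[1 = \<beta> * \<beta> ^ (3 * k)] (mod int p)" using fermat[OF \<beta>] by (simp add: cong_sym)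
    finally have "int p dvd (\<alpha> - \<beta>) * \<beta> ^ (3 * k)" by (simp add: cong_iff_dvd_diff algebra_simps)
    then have "int p dvd \<alpha> - \<beta>" using \<beta> p_int prime_dvd_mult_iff prime_dvd_power by blast
    \<comment> \<open>Here \<open>\<alpha> - \<beta> = x - 3 * y\<close>; eliminating
      \<open>x\<close> leaves 12 y^2, which \<open>p\<close> cannot divide.\<close>
    then have "int p dvd (\<alpha> - \<beta>) * (x + 3 * y)" by simp
    then have "int p dvd (x\<^sup>2 + 3 * y\<^sup>2) - (\<alpha> - \<beta>) * (x + 3 * y)" using dvd by (rule dvd_diff[rotated])
    also have "(x\<^sup>2 + 3 * y\<^sup>2) - (\<alpha> - \<beta>) * (x + 3 * y) = 2 * 2 * 3 * y * y"
      by (simp add: \<alpha>_\<beta>_def algebra_simps power2_eq_square)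
    finally show False using two three y p_int by (simp only: prime_dvd_mult_iff simp_thms)
  qed
  then have "int p dvd 3 * y\<^sup>2" by (simp add: power2_eq_square)
  then have "int p dvd x\<^sup>2" using dvd by (simp add: dvd_add_left_iff)
  then have "int p dvd x" using p_int prime_dvd_power by blast
  with \<open>int p dvd y\<close> show ?thesis by simp
qed

text \<open>The three cases are the splitting types of \<open>p\<close> for x + y sqrt(-3). The
  ramified prime 3 gives a bijection, an inert prime divides both coordinates, and for a split prime
  every representation is divisible by one of two conjugate elements of norm
  \<open>p\<close>.\<close>

lemma card_rep3_prime_mult:
  assumes "prime p" "odd p"
  shows "int (card (rep3 (p * m))) = (1 + chi3 p) * int (card (rep3 m))
    - (if p dvd m then chi3 p * int (card (rep3 (m div p))) else 0)"
proof -
  have p_int: "prime (int p)" using assms by simp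
  consider "p mod 3 = 0" | "p mod 3 = 1" | "p mod 3 = 2" by linarith
  then show ?thesis
  proof cases
    case 1
    then have "p = 3" using assms(1) primes_dvd_imp_eq[of 3 p] by auto
    have "card (rep3 m) = card (rep3 (3 * m))"
    \<comment> \<open>Up to the sign of the first coordinate this is multiplication by
      sqrt(-3).\<close>
    proof (rule card_eq_bij_witness[where f = "\<lambda>(x, y). (3 * y, x)" and g = "\<lambda>(x, y). (y, x div 3)"])
      fix v assume "v \<in> rep3 m"
      then show "(case v of (x, y) \<Rightarrow> (3 * y, x)) \<in> rep3 (3 * m) \<and>
          (case (case v of (x, y) \<Rightarrow> (3 * y, x)) of (x, y) \<Rightarrow> (y, x div 3)) = v"
        by (auto simp: rep3_def power_mult_distrib)
    next
      fix v assume v: "v \<in> rep3 (3 * m)"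
      obtain x y where xy: "v = (x, y)" by (cases v)
      with v have n: "x\<^sup>2 + 3 * y\<^sup>2 = 3 * int m" by (simp add: rep3_def)
      then have "3 dvd x\<^sup>2" by presburger
      then have "3 dvd x" using prime_dvd_power[of "3 :: int"] by simp
      then obtain u where u: "x = 3 * u" by blast
      show "(case v of (x, y) \<Rightarrow> (y, x div 3)) \<in> rep3 m \<and>
          (case (case v of (x, y) \<Rightarrow> (y, x div 3)) of (x, y) \<Rightarrow> (3 * y, x)) = v"
        using n by (simp add: xy u rep3_def power_mult_distrib)
    qed
    from this[symmetric] show ?thesis by (simp add: \<open>p = 3\<close> chi3_def)
  next
    case 3
    have eq: "{(x, y) \<in> rep3 (p * m). int p dvd x \<and> int p dvd y} = rep3 (p * m)"
    proof -
      have "int p dvd x \<and> int p dvd y" if "(x, y) \<in> rep3 (p * m)" for x y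
        using that by (intro inert_prime_dvd[OF assms 3]) (simp add: rep3_def)
      then show ?thesis by blast
    qed
    have "card (rep3 (p * m)) = (if p dvd m then card (rep3 (m div p)) else 0)"
      using card_rep3_both_dvd[OF assms(1), of m] unfolding eq .
    then show ?thesis using 3 by (simp add: chi3_def)
  next
    case 2
    obtain a b where p: "int p = a\<^sup>2 + 3 * b\<^sup>2" using prime_eq_square_plus_3_square[OF assms(1) 2] by blast
    \<comment> \<open>\<open>A\<close> and \<open>B\<close> are the multiples of a + b sqrt(-3) and
      of its conjugate.\<close>
    define A where "A = {(x, y) \<in> rep3 (p * m). int p dvd x * b - y * a}"
    define B where "B = {(x, y) \<in> rep3 (p * m). int p dvd x * (- b) - y * a}"
    have cards: "card A = card (rep3 m)" "card B = card (rep3 m)"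
      using card_rep3_dvd_twist[OF assms(1), of a b m] card_rep3_dvd_twist[OF assms(1), of a "- b" m] p
      by (simp_all add: A_def B_def)
    have two: "\<not> int p dvd 2"
      using assms primes_dvd_imp_eq[of p 2] by (metis even_numeral int_dvd_int_iff of_nat_numeral two_is_prime_nat)
    have b: "\<not> int p dvd b"
    proof
      assume "int p dvd b"
      then obtain c where c: "b = int p * c" by blast
      have "a\<^sup>2 = int p - 3 * (int p * c)\<^sup>2" using p unfolding c by linarith
      also have "\<dots> = int p * (1 - 3 * int p * c\<^sup>2)" by (simp add: power2_eq_square algebra_simps)
      finally have "int p dvd a\<^sup>2" by (rule dvdI)
      then have "int p dvd a" using p_int prime_dvd_power by blast
      then obtain d where d: "a = int p * d" by blast
      have "int p * 1 = (int p * d)\<^sup>2 + 3 * (int p * c)\<^sup>2" using p unfolding c d by linarith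
      also have "\<dots> = int p * (int p * (d\<^sup>2 + 3 * c\<^sup>2))" by (simp add: power2_eq_square algebra_simps)
      finally have "int p * 1 = int p * (int p * (d\<^sup>2 + 3 * c\<^sup>2))" .
      then have "int p * (d\<^sup>2 + 3 * c\<^sup>2) = 1" using p_int by (metis mult_cancel_left not_prime_0)
      then have "int p dvd 1" by (metis dvd_triv_left)
      then show False using p_int not_prime_unit by blast
    qed
    have a: "\<not> int p dvd a"
    proof
      assume "int p dvd a"
      then obtain d where d: "a = int p * d" by blast
      have "3 * b\<^sup>2 = int p - (int p * d)\<^sup>2" using p unfolding d by linarith
      also have "\<dots> = int p * (1 - int p * d\<^sup>2)" by (simp add: power2_eq_square algebra_simps)
      finally have "int p dvd 3 * b\<^sup>2" by (rule dvdI)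
      then have "int p dvd 3" using b p_int prime_dvd_mult_iff prime_dvd_power by blast
      then have "p dvd 3" by presburger
      then show False using assms(1) 2 primes_dvd_imp_eq[of p 3] by auto
    qed
    \<comment> \<open>Modulo \<open>p\<close>, a^2 = -3 b^2 and x^2 = -3 y^2, so the product of the
      two linear conditions vanishes.\<close>
    have union: "rep3 (p * m) = A \<union> B"
    proof -
      have "(x, y) \<in> A \<union> B" if "(x, y) \<in> rep3 (p * m)" for x y
      proof -
        have x2: "x\<^sup>2 = int p * int m - 3 * y\<^sup>2" using that by (simp add: rep3_def)
        have a2: "a\<^sup>2 = int p - 3 * b\<^sup>2" using p by simp
        have "(x * b - y * a) * (x * (- b) - y * a) = y\<^sup>2 * a\<^sup>2 - x\<^sup>2 * b\<^sup>2"
          by (simp add: power2_eq_square algebra_simps)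
        also have "\<dots> = int p * (y\<^sup>2 - int m * b\<^sup>2)"
          unfolding x2 a2 by (simp add: algebra_simps)
        finally have "int p dvd (x * b - y * a) * (x * (- b) - y * a)" by (rule dvdI)
        then show ?thesis using p_int that by (auto simp: A_def B_def prime_dvd_mult_iff)
      qed
      then show ?thesis by (auto simp: A_def B_def)
    qed
    \<comment> \<open>Subtracting and adding the two conditions gives divisibility of
      \<open>2 * x * b\<close> and \<open>2 * y * a\<close>, and \<open>p\<close> divides none of 2,
      \<open>a\<close>, \<open>b\<close>.\<close>
    have inter: "A \<inter> B = {(x, y) \<in> rep3 (p * m). int p dvd x \<and> int p dvd y}"
    proof -
      have fwd: "int p dvd x \<and> int p dvd y" if "int p dvd x * b - y * a" "int p dvd x * (- b) - y * a" for x y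
      proof -
        have "int p dvd (x * b - y * a) - (x * (- b) - y * a)" "int p dvd (x * b - y * a) + (x * (- b) - y * a)"
          using that by (rule dvd_diff, rule dvd_add)
        then have "int p dvd 2 * x * b" "int p dvd 2 * y * a" by (simp_all add: algebra_simps)
        then show ?thesis using two a b p_int by (simp add: prime_dvd_mult_iff)
      qed
      have bwd: "int p dvd x * b - y * a" "int p dvd x * (- b) - y * a" if "int p dvd x" "int p dvd y" for x y
        using that by simp_all
      have "int p dvd x * b - y * a \<and> int p dvd x * (- b) - y * a \<longleftrightarrow> int p dvd x \<and> int p dvd y" for x y
        using fwd[of x y] bwd[of x y] by argo
      then show ?thesis unfolding A_def B_def by (auto simp del: mult_minus_right)
    qed
    have "finite A" "finite B" using finite_rep3[of "p * m"] union by auto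
    then have "card A + card B = card (A \<union> B) + card (A \<inter> B)" by (rule card_Un_Int)
    then have "int (card (rep3 (p * m))) = 2 * int (card (rep3 m)) - int (card (A \<inter> B))"
      unfolding union cards by linarith
    then show ?thesis unfolding inter card_rep3_both_dvd[OF assms(1)] using 2 by (simp add: chi3_def)
  qed
qed

text \<open>Both sides equal 2 at 1 and obey the same recursion under multiplication by an odd
  prime.\<close>

theorem card_rep3_eq_sum_chi3:
  assumes "odd n"
  shows "int (card (rep3 n)) = 2 * (\<Sum>d | d dvd n. chi3 d)"
  using assms
proof (induction n rule: less_induct)
  case (less n)
  show ?case
  proof (cases "n = 1")
    case True
    have "rep3 1 = {(1, 0), (-1, 0)}"
    proof -
      have "(x, y) \<in> {(1, 0), (-1, 0)}" if "x\<^sup>2 + 3 * y\<^sup>2 = 1" for x y :: int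
      proof -
        have "y\<^sup>2 = 0" using that zero_le_power2[of x] zero_le_power2[of y] by linarith
        then show ?thesis using that by (auto simp: power2_eq_1_iff)
      qed
      then show ?thesis by (auto simp: rep3_def)
    qed
    then show ?thesis using True by (simp add: chi3_def)
  next
    case False
    then obtain p where p: "prime p" "p dvd n" using prime_factor_nat by blast
    then obtain m where m: "n = p * m" by blast
    have odd: "odd p" "odd m" using less.prems m by auto
    have "m > 0" using odd by (auto intro: odd_pos)
    have "m < n" using prime_gt_1_nat[OF p(1)] \<open>m > 0\<close> m by simp
    have IHm: "int (card (rep3 m)) = 2 * (\<Sum>d | d dvd m. chi3 d)"
      using less.IH \<open>m < n\<close> odd by blast
    have IHl: "int (card (rep3 (m div p))) = 2 * (\<Sum>d | d dvd m div p. chi3 d)" if "p dvd m"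
    proof -
      have "m div p < n" using \<open>m < n\<close> div_le_dividend le_less_trans by blast
      moreover have "odd (m div p)" using that odd by (metis dvd_mult_div_cancel even_mult_iff)
      ultimately show ?thesis using less.IH by blast
    qed
    show ?thesis
      unfolding m card_rep3_prime_mult[OF p(1) odd(1)] sum_chi3_prime_mult[OF p(1) \<open>m > 0\<close>]
      using IHm IHl by (simp add: algebra_simps)
  qed
qed

section \<open>The eta product as a theta series\<close>

definition tri :: "nat \<Rightarrow> nat" where "tri s = s * Suc s div 2"

lemma two_tri: "2 * tri s = s * Suc s"
  by (simp add: tri_def)

lemma square_eq_tri: "(2 * int s + 1)\<^sup>2 = 8 * int (tri s) + 1"
proof -
  have "int (2 * tri s) = int (s * Suc s)" by (simp only: two_tri)
  then show ?thesis by (simp add: power2_eq_square algebra_simps)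
qed

lemma tri_double: "tri (2 * n) = n * (2 * n + 1)" "tri (2 * n + 1) = (n + 1) * (2 * n + 1)"
  by (simp_all add: tri_def algebra_simps)

text \<open>
  Shanks' finite form of Gauss's product formula for \<open>\<psi>(q)\<close>: modulo \<open>q^(2n+1)\<close> only the term \<open>s = 0\<close>
  survives on the right.
\<close>

theorem shanks_triangular:
  fixes q :: "'a :: comm_ring_1"
  shows "(\<Prod>k<n. 1 - q ^ (2 * k + 1)) * (\<Sum>s<2 * n. q ^ tri s) =
    (\<Sum>s<n. q ^ (s * (2 * n + 1)) * ((\<Prod>k<s. 1 - q ^ (2 * k + 1)) * (\<Prod>k=s..<n. 1 - q ^ (2 * k + 2))))"
proof (induction n)
  case (Suc n)
  define D where "D = (\<lambda>s. \<Prod>k<s. 1 - q ^ (2 * k + 1))"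
  define E where "E = (\<lambda>s n. \<Prod>k=s..<n. 1 - q ^ (2 * k + 2))"
  \<comment> \<open>The telescoping certificate: raising \<open>n\<close> by one multiplies the term
    \<open>s\<close> by \<open>1 - r\<close> and adds \<open>G (Suc s) - G s\<close>. The value at 0
    is set apart because \<open>s - 1\<close> is truncated there; it matches the vanishing factor
    \<open>1 - q ^ (2 * s)\<close> in \<open>Gs\<close>.\<close>
  define G where "G = (\<lambda>s. if s = 0 then 0 else q ^ (s * (2 * n + 1)) * (D s * E (s - 1) n))"
  define r where "r = q ^ (2 * n + 1)"
  have D_Suc: "D (Suc s) = D s * (1 - q ^ (2 * s + 1))" for s by (simp add: D_def)
  have Gs: "G s = r ^ s * (D s * E s n) * (1 - q ^ (2 * s))" if "s \<le> n" for s
  proof (cases s)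
    case (Suc t)
    have "E t n = (1 - q ^ (2 * t + 2)) * E (Suc t) n"
      using that unfolding E_def Suc by (subst prod.atLeast_Suc_lessThan) auto
    moreover have "q ^ (Suc t * (2 * n + 1)) = r ^ Suc t"
      unfolding r_def power_mult[symmetric] by (simp only: mult.commute)
    ultimately have "G s = r ^ Suc t * (D (Suc t) * ((1 - q ^ (2 * t + 2)) * E (Suc t) n))"
      unfolding G_def Suc by simp
    then show ?thesis by (simp add: Suc mult_ac)
  qed (simp add: G_def)
  have GSuc: "G (Suc s) = r ^ Suc s * (D s * E s n) * (1 - q ^ (2 * s + 1))" for s
  proof -
    have "q ^ (Suc s * (2 * n + 1)) = r ^ Suc s"
      unfolding r_def power_mult[symmetric] by (simp only: mult.commute)
    then show ?thesis unfolding G_def by (simp add: D_Suc algebra_simps)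
  qed
  have step: "q ^ (s * (2 * Suc n + 1)) * (D s * E s (Suc n)) =
      (1 - r) * (q ^ (s * (2 * n + 1)) * (D s * E s n)) + (G (Suc s) - G s)" if "s \<le> n" for s
  proof -
    have 1: "E s (Suc n) = E s n * (1 - q * r)" using that by (simp add: E_def r_def)
    have 2: "q ^ (s * (2 * Suc n + 1)) = r ^ s * q ^ (2 * s)"
      unfolding r_def power_mult[symmetric] power_add[symmetric] by (simp add: algebra_simps)
    have 3: "q ^ (s * (2 * n + 1)) = r ^ s"
      unfolding r_def power_mult[symmetric] by (simp only: mult.commute)
    show ?thesis unfolding 1 2 3 Gs[OF that] GSuc by (simp add: algebra_simps)
  qed
  have "(\<Sum>s<Suc n. q ^ (s * (2 * Suc n + 1)) * (D s * E s (Suc n))) =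
      (\<Sum>s<Suc n. (1 - r) * (q ^ (s * (2 * n + 1)) * (D s * E s n)) + (G (Suc s) - G s))"
    by (rule sum.cong) (use step in auto)
  also have "\<dots> = (1 - r) * (\<Sum>s<Suc n. q ^ (s * (2 * n + 1)) * (D s * E s n)) + (G (Suc n) - G 0)"
    by (simp only: sum.distrib sum_distrib_left sum_lessThan_telescope)
  \<comment> \<open>The extra term \<open>s = n\<close> and the boundary value
    \<open>G (Suc n)\<close> supply the two new powers \<open>q ^ tri (2 * n)\<close> and
    \<open>q ^ tri (2 * n + 1)\<close> of the triangular sum.\<close>
  also have "(\<Sum>s<Suc n. q ^ (s * (2 * n + 1)) * (D s * E s n)) = D n * (\<Sum>s<2 * n. q ^ tri s) + q ^ tri (2 * n) * D n"
    using Suc.IH by (simp add: D_def E_def tri_double)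
  also have "G (Suc n) - G 0 = q ^ tri (2 * n + 1) * D (Suc n)"
    unfolding tri_double by (simp add: G_def E_def)
  also have "(1 - r) * (D n * (\<Sum>s<2 * n. q ^ tri s) + q ^ tri (2 * n) * D n) + q ^ tri (2 * n + 1) * D (Suc n) =
      D (Suc n) * (\<Sum>s<2 * Suc n. q ^ tri s)"
    by (simp add: D_Suc r_def algebra_simps)
  finally show ?case by (simp only: D_def E_def)
qed simp

text \<open>Gauss's product as a congruence, without infinite products and in any commutative ring,
  so that it can be used at \<open>q\<close> and at \<open>- q\<close>.\<close>

lemma power_dvd_triangular_sum:
  fixes q :: "'a :: comm_ring_1"
  assumes "n > 0"
  shows "q ^ (2 * n + 1) dvd (\<Prod>k<n. 1 - q ^ (2 * k + 1)) * (\<Sum>s<2 * n. q ^ tri s) - (\<Prod>k<n. 1 - q ^ (2 * k + 2))"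
proof -
  let ?f = "\<lambda>s. q ^ (s * (2 * n + 1)) * ((\<Prod>k<s. 1 - q ^ (2 * k + 1)) * (\<Prod>k=s..<n. 1 - q ^ (2 * k + 2)))"
  have "sum ?f {..<n} = ?f 0 + sum ?f ({..<n} - {0})"
    using assms by (intro sum.remove) auto
  moreover have "?f 0 = (\<Prod>k<n. 1 - q ^ (2 * k + 2))" by (simp add: lessThan_atLeast0)
  moreover have "q ^ (2 * n + 1) dvd sum ?f ({..<n} - {0})"
  proof (rule dvd_sum)
    fix s assume "s \<in> {..<n} - {0}"
    then have "1 * (2 * n + 1) \<le> s * (2 * n + 1)" by (intro mult_right_mono) auto
    then have "q ^ (2 * n + 1) dvd q ^ (s * (2 * n + 1))" by (intro le_imp_power_dvd) simp
    then show "q ^ (2 * n + 1) dvd ?f s" by (rule dvd_mult2)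
  qed
  ultimately show ?thesis unfolding shanks_triangular by simp
qed

text \<open>Modulo \<open>q ^ r\<close> the factor \<open>1 - q ^ e\<close> is invertible: its
  inverse is a geometric sum with \<open>r\<close> terms.\<close>

lemma power_dvd_cancel_one_minus:
  fixes q :: "'a :: comm_ring_1"
  assumes "e > 0" "q ^ r dvd (1 - q ^ e) * y"
  shows "q ^ r dvd y"
proof -
  have "y = (1 - (q ^ e) ^ r) * y + (q ^ e) ^ r * y" by (simp add: algebra_simps)
  also have "1 - (q ^ e) ^ r = (1 - q ^ e) * (\<Sum>i<r. (q ^ e) ^ i)" by (rule one_diff_power_eq)
  finally have "y = ((1 - q ^ e) * y) * (\<Sum>i<r. (q ^ e) ^ i) + (q ^ e) ^ r * y"
    by (simp only: mult_ac)
  moreover have "q ^ r dvd (q ^ e) ^ r"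
    unfolding power_mult[symmetric] using assms(1) by (intro le_imp_power_dvd) simp
  ultimately show ?thesis using assms(2) by (metis dvd_add dvd_mult2)
qed

lemma power_dvd_cancel_prod:
  fixes q :: "'a :: comm_ring_1" and n :: nat
  assumes "\<And>k. e k > 0" "q ^ r dvd (\<Prod>k<n. 1 - q ^ e k) * y"
  shows "q ^ r dvd y"
  using assms(2)
proof (induction n arbitrary: y)
  case (Suc n)
  then have "q ^ r dvd (\<Prod>k<n. 1 - q ^ e k) * ((1 - q ^ e n) * y)" by (simp only: prod.lessThan_Suc mult.assoc)
  then have "q ^ r dvd (1 - q ^ e n) * y" by (rule Suc.IH)
  then show ?case by (rule power_dvd_cancel_one_minus[OF assms(1)])
qed simp

lemma power_dvd_prod_tail:
  fixes q :: "'a :: comm_ring_1"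
  shows "q ^ (2 * n + 1) dvd (\<Prod>k<n + m. 1 - q ^ (2 * k + 2)) - (\<Prod>k<n. 1 - q ^ (2 * k + 2))"
proof (induction m)
  case (Suc m)
  have "(\<Prod>k<n + Suc m. 1 - q ^ (2 * k + 2)) - (\<Prod>k<n. 1 - q ^ (2 * k + 2)) =
    ((\<Prod>k<n + m. 1 - q ^ (2 * k + 2)) - (\<Prod>k<n. 1 - q ^ (2 * k + 2)))
     - q ^ (2 * (n + m) + 2) * (\<Prod>k<n + m. 1 - q ^ (2 * k + 2))"
    by (simp add: algebra_simps)
  moreover have "q ^ (2 * n + 1) dvd q ^ (2 * (n + m) + 2)" by (intro le_imp_power_dvd) simp
  ultimately show ?case using Suc by (metis dvd_diff dvd_mult2)
qed simp

text \<open>By Gauss, \<open>D * P\<close> and \<open>D' * P'\<close> both agree with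
  \<open>F\<close> modulo \<open>q ^ r\<close>, and so does \<open>D * D' * F2\<close>. Cancelling
  the invertible \<open>D * D'\<close> leaves \<open>P * P' = F * F2\<close>.\<close>

lemma power_dvd_psi_psi_minus:
  fixes q :: "'a :: comm_ring_1"
  assumes "n > 0"
  shows "q ^ (2 * n + 1) dvd (\<Sum>s<2 * n. q ^ tri s) * (\<Sum>s<2 * n. (- q) ^ tri s)
    - (\<Prod>k<n. (1 - q ^ (2 * k + 2)) * (1 - q ^ (4 * k + 4)))"
proof -
  define r where "r = 2 * n + 1"
  define D where "D = (\<Prod>k<n. 1 - q ^ (2 * k + 1))"
  define D' where "D' = (\<Prod>k<n. 1 - (- q) ^ (2 * k + 1))"
  define F where "F = (\<Prod>k<n. 1 - q ^ (2 * k + 2))"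
  define F2 where "F2 = (\<Prod>k<n. 1 - q ^ (4 * k + 4))"
  define P where "P = (\<Sum>s<2 * n. q ^ tri s)"
  define P' where "P' = (\<Sum>s<2 * n. (- q) ^ tri s)"
  have 1: "q ^ r dvd D * P - F"
    using power_dvd_triangular_sum[OF assms, of q] by (simp add: D_def P_def F_def r_def)
  have "(- q) ^ r dvd D' * P' - F"
    using power_dvd_triangular_sum[OF assms, of "- q"] by (simp add: D'_def P'_def F_def r_def)
  moreover have "(- q) ^ r = - (q ^ r)" by (simp add: r_def)
  ultimately have 2: "q ^ r dvd D' * P' - F" by simp
  have DD': "D * D' = (\<Prod>k<n. 1 - q ^ (4 * k + 2))"
    unfolding D_def D'_def prod.distrib[symmetric]
  proof (rule prod.cong)
    fix k
    have "q ^ (4 * k + 2) = q ^ (2 * k + 1) * q ^ (2 * k + 1)"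
      unfolding power_add[symmetric] by (rule arg_cong[where f = "\<lambda>m. q ^ m"]) simp
    then show "(1 - q ^ (2 * k + 1)) * (1 - (- q) ^ (2 * k + 1)) = 1 - q ^ (4 * k + 2)"
      by (simp add: algebra_simps)
  qed simp
  \<comment> \<open>The even exponents up to \<open>4 * m\<close> are sorted by their residue modulo
    4.\<close>
  have "(\<Prod>k<m. 1 - q ^ (4 * k + 2)) * (\<Prod>k<m. 1 - q ^ (4 * k + 4)) = (\<Prod>k<m + m. 1 - q ^ (2 * k + 2))" for m
  proof (induction m)
    case (Suc m)
    have "(\<Prod>k<Suc m + Suc m. 1 - q ^ (2 * k + 2)) =
        (\<Prod>k<m + m. 1 - q ^ (2 * k + 2)) * (1 - q ^ (4 * m + 2)) * (1 - q ^ (4 * m + 4))"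
    proof -
      have "Suc m + Suc m = Suc (Suc (m + m))" "2 * (m + m) + 2 = 4 * m + 2" "2 * Suc (m + m) + 2 = 4 * m + 4"
        by simp_all
      then show ?thesis by (simp only: prod.lessThan_Suc)
    qed
    then show ?case unfolding Suc.IH[symmetric] by (simp only: prod.lessThan_Suc mult_ac)
  qed simp
  then have "D * D' * F2 = (\<Prod>k<n + n. 1 - q ^ (2 * k + 2))" unfolding DD' F2_def .
  then have 3: "q ^ r dvd D * D' * F2 - F" using power_dvd_prod_tail[of q n n] by (simp add: r_def F_def)
  have "D * D' * (P * P' - F * F2) = (D * P - F) * (D' * P') + F * (D' * P' - F) - F * (D * D' * F2 - F)"
    by (simp add: algebra_simps)
  then have "q ^ r dvd D * D' * (P * P' - F * F2)" using 1 2 3 by (metis dvd_add dvd_diff dvd_mult dvd_mult2)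
  then have "q ^ r dvd P * P' - F * F2" unfolding DD' by (rule power_dvd_cancel_prod[rotated]) simp
  then show ?thesis by (simp add: r_def P_def P'_def F_def F2_def prod.distrib)
qed

text \<open>The factors with exponents in 2 and 4 form \<psi>(q) \<psi>(-q), and those in 6 and 12
  form the same product at q^3. The truncation errors are multiples of
  \<open>fps_X ^ (2 * n + 1)\<close>, too high to reach the coefficient \<open>M\<close>.\<close>

lemma eta_coeff_eq_nth_psi:
  assumes "M \<le> n" "n > 0"
  shows "eta_coeff M = fps_nth (fps_X * (((\<Sum>s<2 * n. fps_X ^ tri s) * (\<Sum>s<2 * n. (- fps_X) ^ tri s)) *
     ((\<Sum>s<2 * n. (fps_X ^ 3) ^ tri s) * (\<Sum>s<2 * n. (- (fps_X ^ 3)) ^ tri s)))) M"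
    (is "_ = fps_nth (fps_X * (?A * ?B)) M")
proof -
  let ?X = "fps_X :: int fps"
  define C where "C = (\<Prod>k<n. (1 - ?X ^ (2 * k + 2)) * (1 - ?X ^ (4 * k + 4)))"
  define D where "D = (\<Prod>k<n. (1 - (?X ^ 3) ^ (2 * k + 2)) * (1 - (?X ^ 3) ^ (4 * k + 4)))"
  have "(\<Prod>k<n. eta_factor ?X k) = C * D"
    unfolding C_def D_def prod.distrib[symmetric]
  proof (rule prod.cong)
    fix k
    have "2 * Suc k = 2 * k + 2" "4 * Suc k = 4 * k + 4" "6 * Suc k = 3 * (2 * k + 2)" "12 * Suc k = 3 * (4 * k + 4)"
      by simp_all
    then show "eta_factor ?X k = (1 - ?X ^ (2 * k + 2)) * (1 - ?X ^ (4 * k + 4)) *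
        ((1 - (?X ^ 3) ^ (2 * k + 2)) * (1 - (?X ^ 3) ^ (4 * k + 4)))"
      by (simp only: eta_factor_def power_mult mult.assoc)
  qed simp
  then have eta: "eta_coeff M = fps_nth (?X * (C * D)) M" using eta_coeff_eq_partial[OF assms(1)] by simp
  have "?X ^ (2 * n + 1) dvd ?A - C" unfolding C_def by (rule power_dvd_psi_psi_minus[OF assms(2)])
  moreover have "?X ^ (2 * n + 1) dvd ?B - D"
  proof -
    have "(?X ^ 3) ^ (2 * n + 1) dvd ?B - D" unfolding D_def by (rule power_dvd_psi_psi_minus[OF assms(2)])
    moreover have "?X ^ (2 * n + 1) dvd (?X ^ 3) ^ (2 * n + 1)"
      unfolding power_mult[symmetric] by (intro le_imp_power_dvd) simp
    ultimately show ?thesis using dvd_trans by blast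
  qed
  moreover have "?X * (?A * ?B) - ?X * (C * D) = (?A - C) * (?X * ?B) + (?B - D) * (?X * C)"
    by (simp add: algebra_simps)
  ultimately have "?X ^ (2 * n + 1) dvd ?X * (?A * ?B) - ?X * (C * D)" by (metis dvd_add dvd_mult2)
  then obtain H where "?X * (?A * ?B) - ?X * (C * D) = ?X ^ (2 * n + 1) * H" by blast
  then have "fps_nth (?X * (?A * ?B) - ?X * (C * D)) M = 0"
    using assms by (simp only: fps_X_power_mult_nth) simp
  then show ?thesis unfolding eta fps_sub_nth by linarith
qed

lemma fps_monomial_sums_mult:
  "(\<Sum>i\<in>A. fps_const (c i) * fps_X ^ f i) * (\<Sum>j\<in>B. fps_const (d j) * fps_X ^ g j) =
    (\<Sum>(i, j)\<in>A \<times> B. fps_const (c i * d j :: 'a :: comm_ring_1) * fps_X ^ (f i + g j))"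
  by (simp add: sum_product sum.cartesian_product power_add mult_ac flip: fps_const_mult)

lemma eta_coeff_eq_sum_tri:
  "eta_coeff M = (\<Sum>(s, t, u, v) | 1 + tri s + tri t + 3 * tri u + 3 * tri v = M. (-1) ^ (tri t + tri v))"
proof -
  let ?X = "fps_X :: int fps"
  \<comment> \<open>With this \<open>n\<close>, every index contributing to the coefficient of
    \<open>M\<close> lies in \<open>?I\<close>, because \<open>s \<le> tri s\<close>.\<close>
  define n where "n = Suc M"
  let ?I = "{..<2 * n}"
  have n: "n > 0" "M \<le> n" by (simp_all add: n_def)
  have le: "s \<le> tri s" for s using two_tri[of s] by (cases s) auto
  have minus: "(- (?X ^ e)) ^ k = fps_const ((-1) ^ k) * ?X ^ (e * k)" for e k
    by (simp add: power_minus[of "?X ^ e"] power_mult fps_const_power[symmetric] flip: fps_const_neg)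
  have minus1: "(- ?X) ^ k = fps_const ((-1) ^ k) * ?X ^ k" for k
    using minus[of 1 k] by (simp only: power_one_right mult_1)
  have psi: "(\<Sum>s\<in>?I. ?X ^ tri s) = (\<Sum>s\<in>?I. fps_const 1 * ?X ^ tri s)"
    "(\<Sum>s\<in>?I. (- ?X) ^ tri s) = (\<Sum>s\<in>?I. fps_const ((-1) ^ tri s) * ?X ^ tri s)"
    "(\<Sum>s\<in>?I. (?X ^ 3) ^ tri s) = (\<Sum>s\<in>?I. fps_const 1 * ?X ^ (3 * tri s))"
    "(\<Sum>s\<in>?I. (- (?X ^ 3)) ^ tri s) = (\<Sum>s\<in>?I. fps_const ((-1) ^ tri s) * ?X ^ (3 * tri s))"
    by (simp_all only: minus1 minus fps_const_1_eq_1 mult_1 power_mult)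
  define f where "f = (\<lambda>((s, t), (u, v)). tri s + tri t + (3 * tri u + 3 * tri v))"
  define c where "c = (\<lambda>((s :: nat, t), (u :: nat, v)). (-1) ^ tri t * (-1) ^ tri v :: int)"
  have "eta_coeff M = fps_nth (?X * (\<Sum>p\<in>(?I \<times> ?I) \<times> (?I \<times> ?I). fps_const (c p) * ?X ^ f p)) M"
    unfolding eta_coeff_eq_nth_psi[OF n(2,1)] psi fps_monomial_sums_mult case_prod_unfold f_def c_def by simp
  also have "\<dots> = (\<Sum>p\<in>(?I \<times> ?I) \<times> (?I \<times> ?I). if 1 + f p = M then c p else 0)"
    by (auto simp: sum_distrib_left fps_sum_nth mult.left_commute[of ?X] fps_mult_left_const_nth
        fps_X_power_nth simp flip: power_Suc intro!: sum.cong)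
  also have "\<dots> = (\<Sum>p\<in>{p \<in> (?I \<times> ?I) \<times> (?I \<times> ?I). 1 + f p = M}. c p)"
    by (rule sum.inter_filter[symmetric]) simp
  also have "\<dots> = (\<Sum>(s, t, u, v) | 1 + tri s + tri t + 3 * tri u + 3 * tri v = M. (-1) ^ (tri t + tri v))"
  proof (rule sum.reindex_bij_witness[where i = "\<lambda>(s, t, u, v). ((s, t), (u, v))"
        and j = "\<lambda>((s, t), (u, v)). (s, t, u, v)"], goal_cases)
    case (4 p)
    obtain s t u v where p: "p = (s, t, u, v)" by (cases p)
    with 4 have "1 + tri s + tri t + 3 * tri u + 3 * tri v = M" by simp
    then have "s < 2 * n" "t < 2 * n" "u < 2 * n" "v < 2 * n"
      using le[of s] le[of t] le[of u] le[of v] by (simp_all add: n_def)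
    then show ?case using 4 by (simp add: p f_def)
  qed (auto simp: f_def c_def power_add)
  finally show ?thesis .
qed

text \<open>On odd numbers this is the Jacobi symbol \<open>(2/x)\<close>.\<close>

definition eps :: "int \<Rightarrow> int" where
  "eps x = (if x mod 8 = 1 \<or> x mod 8 = 7 then 1 else -1)"

text \<open>The parity of \<open>tri s\<close> depends only on \<open>s\<close> modulo 4, that is,
  on \<open>2 * s + 1\<close> modulo 8.\<close>

lemma eps_odd_eq: "(-1) ^ tri s = eps (2 * int s + 1)"
proof -
  have "s = 4 * (s div 4) + s mod 4" by simp
  then obtain k r where s: "s = 4 * k + r" "r < 4" by (metis mod_less_divisor zero_less_numeral)
  have "2 * tri s = s * Suc s" by (rule two_tri)
  also have "\<dots> = 2 * (8 * k * k + 4 * k * r + 2 * k + tri r)"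
    using two_tri[of r] unfolding s by (simp add: algebra_simps)
  finally have "tri s = 2 * (4 * k * k + 2 * k * r + k) + tri r" by simp
  then have "even (tri s) \<longleftrightarrow> even (tri r)" by simp
  moreover have "r = 0 \<or> r = 1 \<or> r = 2 \<or> r = 3" using s by auto
  moreover have "(2 * int s + 1) mod 8 = (2 * int r + 1) mod 8"
    by (simp add: s mod_eq_dvd_iff)
  ultimately show ?thesis by (auto simp: eps_def tri_def minus_one_power_iff)
qed

definition odd_reps :: "nat \<Rightarrow> (int \<times> int \<times> int \<times> int) set" where
  "odd_reps M = {(x, y, z, w). odd x \<and> odd y \<and> odd z \<and> odd w \<and> x\<^sup>2 + y\<^sup>2 + 3 * z\<^sup>2 + 3 * w\<^sup>2 = 8 * int M}"

text \<open>Multiplying the triangular equation by 8 and completing squares adds the constant 1 + 1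
  + 3 + 3 = 8, exactly the contribution of the leading factor \<open>fps_X\<close>.\<close>

lemma eta_coeff_eq_sum_eps:
  "eta_coeff M = (\<Sum>(x, y, z, w)\<in>{(x, y, z, w) \<in> odd_reps M. x > 0 \<and> y > 0 \<and> z > 0 \<and> w > 0}. eps y * eps w)"
  unfolding eta_coeff_eq_sum_tri
proof (rule sum.reindex_bij_witness[where j = "\<lambda>(s, t, u, v). (2 * int s + 1, 2 * int t + 1, 2 * int u + 1, 2 * int v + 1)"
      and i = "\<lambda>(x, y, z, w). (nat (x div 2), nat (y div 2), nat (z div 2), nat (w div 2))"], goal_cases)
  case (2 p)
  then show ?case by (auto simp: odd_reps_def square_eq_tri)
next
  case (4 p)
  then obtain x y z w where p: "p = (x, y, z, w)" "odd x" "odd y" "odd z" "odd w"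
    "x > 0" "y > 0" "z > 0" "w > 0" "x\<^sup>2 + y\<^sup>2 + 3 * z\<^sup>2 + 3 * w\<^sup>2 = 8 * int M"
    by (auto simp: odd_reps_def)
  have *: "2 * int (nat (a div 2)) + 1 = a" if "odd a" "a > 0" for a :: int
    using that by (auto elim!: oddE)
  have sq: "a\<^sup>2 = 8 * int (tri (nat (a div 2))) + 1" if "odd a" "a > 0" for a :: int
    using square_eq_tri[of "nat (a div 2)"] unfolding *[OF that] .
  show ?case using p(10) sq[OF p(2,6)] sq[OF p(3,7)] sq[OF p(4,8)] sq[OF p(5,9)] by (simp add: p(1))
next
  case (3 p)
  have *: "2 * int (nat (a div 2)) + 1 = a" if "odd a" "a > 0" for a :: int
    using that by (auto elim!: oddE)
  then show ?case using 3 by (auto simp: odd_reps_def)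
qed (auto simp: power_add eps_odd_eq)

section \<open>Representations by \<open>x\<^sup>2 + y\<^sup>2 + 3z\<^sup>2 + 3w\<^sup>2\<close>\<close>

lemma square_mod_8: "x\<^sup>2 mod 8 = (if odd x then 1 else if 4 dvd x then 0 else 4)" for x :: int
proof -
  have "x mod 8 \<in> {0, 1, 2, 3, 4, 5, 6, 7}" by auto
  moreover have "x\<^sup>2 mod 8 = (x mod 8)\<^sup>2 mod 8" by (simp add: power_mod)
  moreover have "even x \<longleftrightarrow> even (x mod 8)" "4 dvd x \<longleftrightarrow> 4 dvd x mod 8" by presburger+
  ultimately show ?thesis by auto
qed

section \<open>Parity classes of the representations and the triangular count\<close>

definition quad_reps :: "int \<Rightarrow> (int \<times> int \<times> int \<times> int) set" where
  "quad_reps M = {(a, p, r, c). a\<^sup>2 + p\<^sup>2 + 3 * r\<^sup>2 + 3 * c\<^sup>2 = M}"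

lemma finite_quad_reps: "finite (quad_reps M)"
proof (rule finite_subset)
  show "quad_reps M \<subseteq> {-M..M} \<times> {-M..M} \<times> {-M..M} \<times> {-M..M}"
  proof
    fix v assume "v \<in> quad_reps M"
    then obtain a p r c where v: "v = (a, p, r, c)" "a\<^sup>2 + p\<^sup>2 + 3 * r\<^sup>2 + 3 * c\<^sup>2 = M"
      by (auto simp: quad_reps_def)
    have "\<bar>a\<bar> \<le> M" "\<bar>p\<bar> \<le> M" "\<bar>r\<bar> \<le> M" "\<bar>c\<bar> \<le> M"
      using abs_le_square[of a] abs_le_square[of p] abs_le_square[of r] abs_le_square[of c] v(2)
        zero_le_power2[of a] zero_le_power2[of p] zero_le_power2[of r] zero_le_power2[of c] by linarith+
    then show "v \<in> {-M..M} \<times> {-M..M} \<times> {-M..M} \<times> {-M..M}" by (auto simp: v)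
  qed
qed simp

lemma quad_reps_mod_8:
  assumes "(a, p, r, c) \<in> quad_reps M"
  shows "(a\<^sup>2 mod 8 + p\<^sup>2 mod 8 + 3 * (r\<^sup>2 mod 8) + 3 * (c\<^sup>2 mod 8)) mod 8 = M mod 8"
proof -
  have "[a\<^sup>2 mod 8 + p\<^sup>2 mod 8 + 3 * (r\<^sup>2 mod 8) + 3 * (c\<^sup>2 mod 8) = a\<^sup>2 + p\<^sup>2 + 3 * r\<^sup>2 + 3 * c\<^sup>2] (mod 8)"
    by (intro cong_add cong_mult cong_refl) (simp_all add: cong_def)
  moreover have "a\<^sup>2 + p\<^sup>2 + 3 * r\<^sup>2 + 3 * c\<^sup>2 = M" using assms by (simp add: quad_reps_def)
  ultimately show ?thesis by (simp only: Cong.cong_def)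
qed

definition mixed_reps :: "int \<Rightarrow> (int \<times> int \<times> int \<times> int) set" where
  "mixed_reps M = {(a, p, r, c) \<in> quad_reps M. odd (p + r) \<and> even (a + c)}"

lemma finite_mixed_reps: "finite (mixed_reps M)"
  by (rule finite_subset[OF _ finite_quad_reps[of M]]) (auto simp: mixed_reps_def)

text \<open>Modulo 4, \<open>r\<close> must be odd. Then a^2 + p^2 + 3 c^2 = 0 modulo 8 with each
  term 0 or 4, so an even number of terms are 4.\<close>

lemma mixed_reps_even:
  assumes "(a, p, r, c) \<in> mixed_reps M" "M mod 8 = 3" "even c"
  shows "even a \<and> even p \<and> odd r \<and> (4 dvd p \<longleftrightarrow> (4 dvd a \<longleftrightarrow> 4 dvd c))"
proof -
  have "even a" and pr: "odd (p + r)" and M: "a\<^sup>2 + p\<^sup>2 + 3 * r\<^sup>2 + 3 * c\<^sup>2 = M"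
    using assms by (auto simp: mixed_reps_def quad_reps_def)
  have "(a\<^sup>2 mod 8 + p\<^sup>2 mod 8 + 3 * (r\<^sup>2 mod 8) + 3 * (c\<^sup>2 mod 8)) mod 8 = 3"
    using quad_reps_mod_8[of a p r c M] M assms(2) by (simp add: quad_reps_def)
  then show ?thesis using pr \<open>even a\<close> \<open>even c\<close> unfolding square_mod_8
    by (cases "even p"; cases "4 dvd a"; cases "4 dvd c"; cases "4 dvd p"; cases "4 dvd r") auto
qed

text \<open>With \<open>a\<close> and \<open>c\<close> odd, a^2 + 3 c^2 is 4 modulo 8, which forces
  r^2 = 1 and p^2 = 4 modulo 8.\<close>

lemma mixed_reps_odd:
  assumes "(a, p, r, c) \<in> mixed_reps M" "M mod 8 = 3" "odd c"
  shows "odd a \<and> odd r \<and> p mod 4 = 2"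
proof -
  have "odd a" and pr: "odd (p + r)" and M: "a\<^sup>2 + p\<^sup>2 + 3 * r\<^sup>2 + 3 * c\<^sup>2 = M"
    using assms by (auto simp: mixed_reps_def quad_reps_def)
  have "(a\<^sup>2 mod 8 + p\<^sup>2 mod 8 + 3 * (r\<^sup>2 mod 8) + 3 * (c\<^sup>2 mod 8)) mod 8 = 3"
    using quad_reps_mod_8[of a p r c M] M assms(2) by (simp add: quad_reps_def)
  then have "odd r \<and> even p \<and> \<not> 4 dvd p" using pr \<open>odd a\<close> \<open>odd c\<close> unfolding square_mod_8
    by (cases "even p"; cases "4 dvd p"; cases "4 dvd r") auto
  then show ?thesis using \<open>odd a\<close> by presburger
qed

text \<open>For odd \<open>M\<close> exactly one of \<open>p + r\<close> and \<open>a + c\<close> is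
  odd, and exchanging the two pairs decides which.\<close>

lemma card_mixed_reps:
  assumes "odd M"
  shows "card (quad_reps M) = 2 * card (mixed_reps M)"
proof -
  have par: "odd (a + p + r + c)" if "(a, p, r, c) \<in> quad_reps M" for a p r c
  proof -
    have "odd (a\<^sup>2 + p\<^sup>2 + 3 * r\<^sup>2 + 3 * c\<^sup>2)" using that assms by (simp add: quad_reps_def)
    then show ?thesis by simp
  qed
  have "card (quad_reps M) = 2 * card {v \<in> quad_reps M. case v of (a, p, r, c) \<Rightarrow> odd (p + r)}"
  proof (rule card_eq_twice_half[OF finite_quad_reps, where f = "\<lambda>(a, p, r, c). (p, a, c, r)"])
    fix v assume v: "v \<in> quad_reps M"
    obtain a p r c where [simp]: "v = (a, p, r, c)" by (cases v)
    show "(case v of (a, p, r, c) \<Rightarrow> (p, a, c, r)) \<in> quad_reps M \<and>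
       (case (case v of (a, p, r, c) \<Rightarrow> (p, a, c, r)) of (a, p, r, c) \<Rightarrow> (p, a, c, r)) = v \<and>
       ((case (case v of (a, p, r, c) \<Rightarrow> (p, a, c, r)) of (a, p, r, c) \<Rightarrow> odd (p + r)) \<longleftrightarrow>
         \<not> (case v of (a, p, r, c) \<Rightarrow> odd (p + r)))"
      using v par[of a p r c] by (simp add: quad_reps_def) presburger
  qed
  also have "{v \<in> quad_reps M. case v of (a, p, r, c) \<Rightarrow> odd (p + r)} = mixed_reps M"
    unfolding mixed_reps_def using par by fastforce
  finally show ?thesis .
qed

text \<open>On a + c sqrt(-3) the map is multiplication by the sixth root of unity (1 - sqrt(-3)) /
  2 followed by conjugation, hence a norm-preserving involution.\<close>

lemma card_mixed_reps_odd:
  assumes "M mod 8 = 3"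
  shows "card {(a, p, r, c) \<in> mixed_reps M. odd c} =
    2 * card {(a, p, r, c) \<in> mixed_reps M. even c \<and> p mod 4 = 2}"
proof -
  \<comment> \<open>For odd \<open>a\<close> and \<open>c\<close> exactly one of
    \<open>a - c\<close> and \<open>a + c\<close> is divisible by 4. Fixing the sign of
    \<open>c\<close> this way makes the image \<open>(a - c) div 2\<close> even.\<close>
  have "card {(a, p, r, c) \<in> mixed_reps M. odd c} =
     2 * card {v \<in> {(a, p, r, c) \<in> mixed_reps M. odd c}. case v of (a, p, r, c) \<Rightarrow> 4 dvd a - c}"
  proof (rule card_eq_twice_half[where f = "\<lambda>(a, p, r, c). (a, p, r, - c)"])
    show "finite {(a, p, r, c) \<in> mixed_reps M. odd c}"
      by (rule finite_subset[OF _ finite_mixed_reps[of M]]) auto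
    fix v assume v: "v \<in> {(a, p, r, c) \<in> mixed_reps M. odd c}"
    obtain a p r c where vv: "v = (a, p, r, c)" by (cases v)
    have h: "(a, p, r, c) \<in> mixed_reps M" "odd c" using v by (auto simp: vv)
    then have "odd a" using mixed_reps_odd[OF h(1) assms] by simp
    then have "4 dvd a + c \<longleftrightarrow> \<not> 4 dvd a - c" using h(2) by presburger
    then show "(case v of (a, p, r, c) \<Rightarrow> (a, p, r, - c)) \<in> {(a, p, r, c) \<in> mixed_reps M. odd c} \<and>
       (case (case v of (a, p, r, c) \<Rightarrow> (a, p, r, - c)) of (a, p, r, c) \<Rightarrow> (a, p, r, - c)) = v \<and>
       ((case (case v of (a, p, r, c) \<Rightarrow> (a, p, r, - c)) of (a, p, r, c) \<Rightarrow> 4 dvd a - c) \<longleftrightarrow>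
         \<not> (case v of (a, p, r, c) \<Rightarrow> 4 dvd a - c))"
      using h by (simp add: vv mixed_reps_def quad_reps_def)
  qed
  also have "card {v \<in> {(a, p, r, c) \<in> mixed_reps M. odd c}. case v of (a, p, r, c) \<Rightarrow> 4 dvd a - c} =
     card {(a, p, r, c) \<in> mixed_reps M. even c \<and> p mod 4 = 2}"
  proof (rule card_eq_bij_witness[where f = "\<lambda>(a, p, r, c). ((a + 3 * c) div 2, p, r, (a - c) div 2)"
        and g = "\<lambda>(a, p, r, c). ((a + 3 * c) div 2, p, r, (a - c) div 2)"])
    fix v assume "v \<in> {v \<in> {(a, p, r, c) \<in> mixed_reps M. odd c}. case v of (a, p, r, c) \<Rightarrow> 4 dvd a - c}"
    then obtain a p r c where v: "v = (a, p, r, c)" "(a, p, r, c) \<in> mixed_reps M" "odd c" "4 dvd a - c"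
      by auto
    from v(4) obtain k where "a - c = 4 * k" by blast
    then have a: "a = c + 4 * k" by simp
    have p: "p mod 4 = 2" using mixed_reps_odd[OF v(2) assms v(3)] by simp
    have d: "(a + 3 * c) div 2 = 2 * c + 2 * k" "(a - c) div 2 = 2 * k"
      "(2 * c + 2 * k + 3 * (2 * k)) div 2 = a" "(2 * c + 2 * k - 2 * k) div 2 = c"
      unfolding a by simp_all
    have "(2 * c + 2 * k)\<^sup>2 + 3 * (2 * k)\<^sup>2 = a\<^sup>2 + 3 * c\<^sup>2"
      unfolding a by (simp add: power2_eq_square algebra_simps)
    then show "(case v of (a, p, r, c) \<Rightarrow> ((a + 3 * c) div 2, p, r, (a - c) div 2)) \<in>
          {(a, p, r, c) \<in> mixed_reps M. even c \<and> p mod 4 = 2} \<and>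
        (case (case v of (a, p, r, c) \<Rightarrow> ((a + 3 * c) div 2, p, r, (a - c) div 2)) of
          (a, p, r, c) \<Rightarrow> ((a + 3 * c) div 2, p, r, (a - c) div 2)) = v"
      unfolding v(1) prod.case d using v(2) p by (simp add: mixed_reps_def quad_reps_def)
  next
    fix v assume "v \<in> {(a, p, r, c) \<in> mixed_reps M. even c \<and> p mod 4 = 2}"
    then obtain a p r c where v: "v = (a, p, r, c)" "(a, p, r, c) \<in> mixed_reps M" "even c" "p mod 4 = 2"
      by auto
    have par: "even a" "4 dvd p \<longleftrightarrow> (4 dvd a \<longleftrightarrow> 4 dvd c)" "odd r"
      using mixed_reps_even[OF v(2) assms v(3)] by auto
    from par(1) v(3) obtain \<alpha> \<gamma> where ac: "a = 2 * \<alpha>" "c = 2 * \<gamma>" by blast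
    have "\<not> 4 dvd p" using v(4) by presburger
    \<comment> \<open>This makes the new last coordinate \<open>\<alpha> - \<gamma>\<close> odd; the
      new difference is \<open>4 * \<gamma>\<close>, as membership in the source set
      demands.\<close>
    then have odd: "odd (\<alpha> + \<gamma>)" using par(2) unfolding ac by presburger
    have d: "(a + 3 * c) div 2 = \<alpha> + 3 * \<gamma>" "(a - c) div 2 = \<alpha> - \<gamma>"
      "(\<alpha> + 3 * \<gamma> + 3 * (\<alpha> - \<gamma>)) div 2 = a" "(\<alpha> + 3 * \<gamma> - (\<alpha> - \<gamma>)) div 2 = c"
      unfolding ac by simp_all
    have "(\<alpha> + 3 * \<gamma>)\<^sup>2 + 3 * (\<alpha> - \<gamma>)\<^sup>2 = a\<^sup>2 + 3 * c\<^sup>2"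
      unfolding ac by (simp add: power2_eq_square algebra_simps)
    then show "(case v of (a, p, r, c) \<Rightarrow> ((a + 3 * c) div 2, p, r, (a - c) div 2)) \<in>
          {v \<in> {(a, p, r, c) \<in> mixed_reps M. odd c}. case v of (a, p, r, c) \<Rightarrow> 4 dvd a - c} \<and>
        (case (case v of (a, p, r, c) \<Rightarrow> ((a + 3 * c) div 2, p, r, (a - c) div 2)) of
          (a, p, r, c) \<Rightarrow> ((a + 3 * c) div 2, p, r, (a - c) div 2)) = v"
      unfolding v(1) prod.case d using v(2) odd by (simp add: mixed_reps_def quad_reps_def)
  qed
  finally show ?thesis .
qed

text \<open>Completing squares adds 1 + 3 + 3 + 4 = 11 to \<open>8 * n\<close>. The square with
  coefficient 4 becomes the square of \<open>4 * w - 2\<close>; conversely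
  \<open>mixed_reps_odd\<close> shows that \<open>p\<close> always has this form.\<close>

lemma tri_rep_count_eq_card_mixed_reps:
  "tri_rep_count 1 3 3 4 n = card {(a, p, r, c) \<in> mixed_reps (8 * int n + 11). odd c}"
  unfolding tri_rep_count_def
proof (rule card_eq_bij_witness[where f = "\<lambda>(x, y, z, w). (2 * x - 1, 4 * w - 2, 2 * y - 1, 2 * z - 1)"
      and g = "\<lambda>(a, p, r, c). ((a + 1) div 2, (r + 1) div 2, (c + 1) div 2, (p + 2) div 4)"])
  have sq: "8 * (x * (x - 1) div 2) = (2 * x - 1)\<^sup>2 - 1" for x :: int
  proof -
    have "2 * (x * (x - 1) div 2) = x * (x - 1)" by (rule dvd_mult_div_cancel) simp
    then have "8 * (x * (x - 1) div 2) = 4 * (x * (x - 1))" by linarith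
    also have "\<dots> = (2 * x - 1)\<^sup>2 - 1" by (simp add: power2_eq_square algebra_simps)
    finally show ?thesis .
  qed
  have sq4: "(4 * w - 2)\<^sup>2 = 4 * (2 * w - 1)\<^sup>2" for w :: int
    by (simp add: power2_eq_square algebra_simps)
  have key: "int n = int 1 * (x * (x - 1) div 2) + int 3 * (y * (y - 1) div 2) + int 3 * (z * (z - 1) div 2)
      + int 4 * (w * (w - 1) div 2) \<longleftrightarrow>
     (2 * x - 1)\<^sup>2 + (4 * w - 2)\<^sup>2 + 3 * (2 * y - 1)\<^sup>2 + 3 * (2 * z - 1)\<^sup>2 = 8 * int n + 11" for x y z w
    using sq[of x] sq[of y] sq[of z] sq[of w] sq4[of w] by simp linarith
  {
    fix v assume v: "v \<in> {(x, y, z, w). int n = int 1 * (x * (x - 1) div 2) + int 3 * (y * (y - 1) div 2)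
        + int 3 * (z * (z - 1) div 2) + int 4 * (w * (w - 1) div 2)}"
    obtain x y z w where vv: "v = (x, y, z, w)" by (cases v)
    show "(case v of (x, y, z, w) \<Rightarrow> (2 * x - 1, 4 * w - 2, 2 * y - 1, 2 * z - 1)) \<in>
        {(a, p, r, c) \<in> mixed_reps (8 * int n + 11). odd c} \<and>
      (case (case v of (x, y, z, w) \<Rightarrow> (2 * x - 1, 4 * w - 2, 2 * y - 1, 2 * z - 1)) of
        (a, p, r, c) \<Rightarrow> ((a + 1) div 2, (r + 1) div 2, (c + 1) div 2, (p + 2) div 4)) = v"
      using v unfolding vv mem_Collect_eq prod.case key by (simp add: mixed_reps_def quad_reps_def)
  next
    fix v assume "v \<in> {(a, p, r, c) \<in> mixed_reps (8 * int n + 11). odd c}"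
    then obtain a p r c where v: "v = (a, p, r, c)" "(a, p, r, c) \<in> mixed_reps (8 * int n + 11)" "odd c"
      by auto
    have "(8 * int n + 11) mod 8 = 3" by presburger
    from mixed_reps_odd[OF v(2) this v(3)] have par: "odd a" "odd r" "p mod 4 = 2" by auto
    have d: "2 * ((a + 1) div 2) - 1 = a" "4 * ((p + 2) div 4) - 2 = p"
      "2 * ((r + 1) div 2) - 1 = r" "2 * ((c + 1) div 2) - 1 = c"
      using par v(3) by presburger+
    show "(case v of (a, p, r, c) \<Rightarrow> ((a + 1) div 2, (r + 1) div 2, (c + 1) div 2, (p + 2) div 4)) \<in>
        {(x, y, z, w). int n = int 1 * (x * (x - 1) div 2) + int 3 * (y * (y - 1) div 2)
        + int 3 * (z * (z - 1) div 2) + int 4 * (w * (w - 1) div 2)} \<and>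
      (case (case v of (a, p, r, c) \<Rightarrow> ((a + 1) div 2, (r + 1) div 2, (c + 1) div 2, (p + 2) div 4)) of
        (x, y, z, w) \<Rightarrow> (2 * x - 1, 4 * w - 2, 2 * y - 1, 2 * z - 1)) = v"
      unfolding v(1) mem_Collect_eq prod.case key d using v(2) by (simp add: mixed_reps_def quad_reps_def)
  }
qed

section \<open>Counting all representations of an odd number by Liouville's identity\<close>

lemma sum_odd_quads_eq_convolution:
  fixes g :: "nat \<Rightarrow> int"
  shows "(\<Sum>(a, b, d, e)\<in>odd_quads (2 * N). g d * g e) =
    (\<Sum>m | odd m \<and> m < 2 * N. (\<Sum>d | d dvd m. g d) * (\<Sum>e | e dvd 2 * N - m. g e))"
proof -
  have pos: "0 < m" "0 < 2 * N - m" if "odd m \<and> m < 2 * N" for m using that by (auto intro: odd_pos)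
  have "(\<Sum>m | odd m \<and> m < 2 * N. (\<Sum>d | d dvd m. g d) * (\<Sum>e | e dvd 2 * N - m. g e)) =
     (\<Sum>m | odd m \<and> m < 2 * N. \<Sum>(d, e)\<in>{d. d dvd m} \<times> {e. e dvd 2 * N - m}. g d * g e)"
    by (simp only: sum_product sum.cartesian_product)
  also have "\<dots> = (\<Sum>(m, d, e)\<in>(SIGMA m:{m. odd m \<and> m < 2 * N}. {d. d dvd m} \<times> {e. e dvd 2 * N - m}). g d * g e)"
    by (subst sum.Sigma) (use pos in \<open>auto intro!: finite_cartesian_product finite_divisors_nat\<close>)
  also have "\<dots> = (\<Sum>(a, b, d, e)\<in>odd_quads (2 * N). g d * g e)"
  proof (rule sum.reindex_bij_witness[where j = "\<lambda>(m, d, e). (m div d, (2 * N - m) div e, d, e)"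
        and i = "\<lambda>(a, b, d, e). (a * d, d, e)"], goal_cases)
    case (2 v)
    obtain m d e where v: "v = (m, d, e)" by (cases v)
    with 2 have m: "odd m" "m < 2 * N" "d dvd m" "e dvd 2 * N - m" by auto
    then have "odd (2 * N - m)" by simp
    have o: "odd (x div y) \<and> odd y" if "y dvd x" "odd x" for x y :: nat
      using that by (metis dvd_mult_div_cancel even_mult_iff)
    show ?case using o[OF m(3,1)] o[OF m(4) \<open>odd (2 * N - m)\<close>] m by (simp add: v odd_quads_def)
  next
    case (3 v)
    obtain a b d e where v: "v = (a, b, d, e)" by (cases v)
    with 3 have q: "odd a" "odd b" "odd d" "odd e" "a * d + b * e = 2 * N" by (auto simp: odd_quads_def)
    then have "2 * N - a * d = b * e" "d > 0" "e > 0" by (auto intro: odd_pos)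
    then show ?case by (simp add: v)
  next
    case (4 v)
    obtain a b d e where v: "v = (a, b, d, e)" by (cases v)
    with 4 have q: "odd a" "odd b" "odd d" "odd e" "a * d + b * e = 2 * N" by (auto simp: odd_quads_def)
    then have "2 * N - a * d = b * e" by simp
    moreover have "b * e > 0" using q by (auto intro: odd_pos)
    then have "a * d < 2 * N" using q(5) by linarith
    ultimately show ?case using q by (simp add: v)
  qed auto
  finally show ?thesis ..
qed

text \<open>This is the shape f(d - e) - f(d + e) required by Liouville's identity, with f the
  indicator of the multiples of 3.\<close>

lemma chi3_mult_eq:
  "chi3 d * chi3 e = (if 3 dvd int d - int e then 1 else 0) - (if 3 dvd int d + int e then 1 else 0)"
proof -
  have "3 dvd int d - int e \<longleftrightarrow> d mod 3 = e mod 3"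
  proof -
    have "d mod 3 = e mod 3 \<longleftrightarrow> int (d mod 3) = int (e mod 3)" by (simp only: of_nat_eq_iff)
    also have "\<dots> \<longleftrightarrow> int d mod 3 = int e mod 3" by (simp only: zmod_int of_nat_numeral)
    finally show ?thesis by (simp only: mod_eq_dvd_iff)
  qed
  moreover have "3 dvd int d + int e \<longleftrightarrow> 3 dvd d + e"
    using int_dvd_int_iff[of 3 "d + e"] by simp
  moreover have "3 dvd d + e \<longleftrightarrow> 3 dvd d mod 3 + e mod 3"
    by (simp only: dvd_eq_mod_eq_0 mod_add_eq)
  moreover have "d mod 3 = 0 \<or> d mod 3 = 1 \<or> d mod 3 = 2" "e mod 3 = 0 \<or> e mod 3 = 1 \<or> e mod 3 = 2" by auto
  ultimately show ?thesis
    by (elim disjE) (simp_all add: chi3_def flip: numeral_2_eq_2 numeral_3_eq_3)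
qed

lemma sum_chi3_odd_quads:
  assumes "odd N"
  shows "(\<Sum>(a, b, d, e)\<in>odd_quads (2 * N). chi3 d * chi3 e) = (\<Sum>\<delta> | \<delta> dvd N \<and> \<not> 3 dvd \<delta>. int \<delta>)"
proof -
  define f :: "int \<Rightarrow> int" where "f = (\<lambda>x. if 3 dvd x then 1 else 0)"
  have fin: "finite {\<delta>. \<delta> dvd N}" using assms by (intro finite_divisors_nat) (auto intro: odd_pos)
  have "(\<Sum>(a, b, d, e)\<in>odd_quads (2 * N). chi3 d * chi3 e) =
      (\<Sum>(a, b, d, e)\<in>odd_quads (2 * N). f (int d - int e) - f (int d + int e))"
    by (simp only: chi3_mult_eq f_def)
  also have "\<dots> = (\<Sum>\<delta> | \<delta> dvd N. int \<delta> * (f 0 - f (2 * int \<delta>)))"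
    by (rule liouville_odd_quads[OF assms]) (simp add: f_def)
  also have "\<dots> = (\<Sum>\<delta> | \<delta> dvd N. if \<not> 3 dvd \<delta> then int \<delta> else 0)"
  proof (rule sum.cong)
    fix \<delta> :: nat
    have "3 dvd 2 * int \<delta> \<longleftrightarrow> 3 dvd \<delta>" by presburger
    then show "int \<delta> * (f 0 - f (2 * int \<delta>)) = (if \<not> 3 dvd \<delta> then int \<delta> else 0)"
      by (simp add: f_def)
  qed simp
  also have "\<dots> = (\<Sum>\<delta> | \<delta> dvd N \<and> \<not> 3 dvd \<delta>. int \<delta>)"
    using sum.inter_filter[OF fin, of int "\<lambda>\<delta>. \<not> 3 dvd \<delta>"] by simp
  finally show ?thesis .
qed

text \<open>Passing to sums and differences within \<open>(a, p)\<close> and \<open>(r, c)\<close>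
  doubles the form and separates it into two values of x^2 + 3 y^2 with sum \<open>2 * N\<close>,
  both odd because \<open>N\<close> is.\<close>

lemma card_quad_reps_eq_convolution:
  assumes "odd N"
  shows "card (quad_reps (int N)) = (\<Sum>m | odd m \<and> m < 2 * N. card (rep3 m) * card (rep3 (2 * N - m)))"
proof -
  let ?K = "SIGMA m:{m. odd m \<and> m < 2 * N}. rep3 m \<times> rep3 (2 * N - m)"
  have sq4: "x\<^sup>2 mod 4 = (if odd x then 1 else 0)" for x :: int
    using square_mod_8[of x] mod_mod_cancel[of 4 8 "x\<^sup>2"] by (auto split: if_splits)
  define f where "f = (\<lambda>(a :: int, p :: int, r :: int, c :: int).
    (nat ((a + p)\<^sup>2 + 3 * (r + c)\<^sup>2), (a + p, r + c), (a - p, r - c)))"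
  define g where "g = (\<lambda>(m :: nat, (x :: int, y :: int), (z :: int, w :: int)).
    ((x + z) div 2, (x - z) div 2, (y + w) div 2, (y - w) div 2))"
  have "card (quad_reps (int N)) = card ?K"
  proof (rule card_eq_bij_witness[where f = f and g = g])
    fix v assume "v \<in> quad_reps (int N)"
    then obtain a p r c where v: "v = (a, p, r, c)" "a\<^sup>2 + p\<^sup>2 + 3 * r\<^sup>2 + 3 * c\<^sup>2 = int N"
      by (auto simp: quad_reps_def)
    define A where "A = (a + p)\<^sup>2 + 3 * (r + c)\<^sup>2"
    define B where "B = (a - p)\<^sup>2 + 3 * (r - c)\<^sup>2"
    have AB: "A + B = 2 * int N"
      unfolding A_def B_def v(2)[symmetric] by (simp add: power2_eq_square algebra_simps)
    have "odd (a\<^sup>2 + p\<^sup>2 + 3 * r\<^sup>2 + 3 * c\<^sup>2)" using v(2) assms by simp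
    then have "odd A" "odd B" by (auto simp: A_def B_def)
    moreover have "A \<ge> 0" "B \<ge> 0" by (auto simp: A_def B_def)
    ultimately have "B > 0" by (cases "B = 0") auto
    have m: "odd (nat A)" "nat A < 2 * N" "int (nat A) = A" "int (2 * N - nat A) = B"
      using \<open>odd A\<close> \<open>A \<ge> 0\<close> \<open>B > 0\<close> AB by (auto simp: even_nat_iff)
    have "(nat A, (a + p, r + c), (a - p, r - c)) \<in> ?K"
      using m unfolding A_def B_def by (simp add: rep3_def)
    then show "f v \<in> ?K \<and> g (f v) = v" by (simp add: v(1) A_def f_def g_def)
  next
    fix v assume v: "v \<in> ?K"
    obtain m x y z w where vv: "v = (m, (x, y), (z, w))" by (metis prod.exhaust)
    have m: "odd m" "m < 2 * N" "x\<^sup>2 + 3 * y\<^sup>2 = int m" "z\<^sup>2 + 3 * w\<^sup>2 = int (2 * N - m)"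
      using v by (auto simp: vv rep3_def)
    have "odd (2 * N - m)" using m by simp
    then have "odd (x\<^sup>2 + 3 * y\<^sup>2)" "odd (z\<^sup>2 + 3 * w\<^sup>2)" using m by simp_all
    then have par: "odd (x + y)" "odd (z + w)" by auto
    have tot: "x\<^sup>2 + 3 * y\<^sup>2 + z\<^sup>2 + 3 * w\<^sup>2 = 2 * int N" using m by linarith
    \<comment> \<open>An odd value of x^2 + 3 y^2 is 1 or 3 modulo 4 according to which variable is
      odd. A sum of 2 modulo 4 forces the same choice in both summands, so the halves are
      integers.\<close>
    have "(2 * int N) mod 4 = 2" using assms by presburger
    moreover have "[x\<^sup>2 mod 4 + 3 * (y\<^sup>2 mod 4) + z\<^sup>2 mod 4 + 3 * (w\<^sup>2 mod 4) = x\<^sup>2 + 3 * y\<^sup>2 + z\<^sup>2 + 3 * w\<^sup>2] (mod 4)"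
      by (intro cong_add cong_mult cong_refl) (simp_all add: Cong.cong_def)
    ultimately have "(x\<^sup>2 mod 4 + 3 * (y\<^sup>2 mod 4) + z\<^sup>2 mod 4 + 3 * (w\<^sup>2 mod 4)) mod 4 = 2"
      by (simp only: Cong.cong_def tot)
    then have "even (x + z)" "even (y + w)" using par unfolding sq4 by (auto split: if_splits)
    then obtain a r where ar: "x + z = 2 * a" "y + w = 2 * r" by (meson evenE)
    define p c where "p = a - z" "c = r - w"
    have xyzw: "x = a + p" "z = a - p" "y = r + c" "w = r - c" using ar by (auto simp: p_c_def)
    have "2 * (a\<^sup>2 + p\<^sup>2 + 3 * r\<^sup>2 + 3 * c\<^sup>2) = 2 * int N"
      unfolding tot[symmetric] xyzw by (simp add: power2_eq_square algebra_simps)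
    then have "(a, p, r, c) \<in> quad_reps (int N)" by (simp add: quad_reps_def)
    moreover have "(x + z) div 2 = a" "(x - z) div 2 = p" "(y + w) div 2 = r" "(y - w) div 2 = c"
      by (simp_all add: xyzw)
    moreover have "f (a, p, r, c) = v"
      unfolding vv f_def prod.case xyzw[symmetric] using m(3) by simp
    ultimately show "g v \<in> quad_reps (int N) \<and> f (g v) = v" by (simp add: vv g_def)
  qed
  also have "card ?K = (\<Sum>m | odd m \<and> m < 2 * N. card (rep3 m) * card (rep3 (2 * N - m)))"
    by (subst card_SigmaI) (auto simp: finite_rep3 card_cartesian_product)
  finally show ?thesis .
qed

theorem card_quad_reps:
  assumes "odd N"
  shows "int (card (quad_reps (int N))) = 4 * (\<Sum>\<delta> | \<delta> dvd N \<and> \<not> 3 dvd \<delta>. int \<delta>)"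
proof -
  have "int (card (quad_reps (int N))) =
     (\<Sum>m | odd m \<and> m < 2 * N. int (card (rep3 m)) * int (card (rep3 (2 * N - m))))"
    unfolding card_quad_reps_eq_convolution[OF assms] by simp
  also have "\<dots> = (\<Sum>m | odd m \<and> m < 2 * N. 4 * ((\<Sum>d | d dvd m. chi3 d) * (\<Sum>e | e dvd 2 * N - m. chi3 e)))"
  proof (rule sum.cong)
    fix m assume "m \<in> {m. odd m \<and> m < 2 * N}"
    then have "odd m" "odd (2 * N - m)" by auto
    from this[THEN card_rep3_eq_sum_chi3] show "int (card (rep3 m)) * int (card (rep3 (2 * N - m))) =
        4 * ((\<Sum>d | d dvd m. chi3 d) * (\<Sum>e | e dvd 2 * N - m. chi3 e))"
      by simp
  qed simp
  also have "\<dots> = 4 * (\<Sum>(a, b, d, e)\<in>odd_quads (2 * N). chi3 d * chi3 e)"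
    unfolding sum_odd_quads_eq_convolution by (simp only: sum_distrib_left)
  finally show ?thesis unfolding sum_chi3_odd_quads[OF assms] .
qed

lemma divisors_prime_to_3:
  fixes n :: nat
  assumes "n > 0" "\<not> 3 dvd n"
  shows "{\<delta>. \<delta> dvd 3 ^ \<beta> * n \<and> \<not> 3 dvd \<delta>} = {\<delta>. \<delta> dvd n}"
proof (intro equalityI subsetI)
  fix \<delta> assume "\<delta> \<in> {\<delta>. \<delta> dvd 3 ^ \<beta> * n \<and> \<not> 3 dvd \<delta>}"
  then have d: "\<delta> dvd 3 ^ \<beta> * n" "\<not> 3 dvd \<delta>" by auto
  have "coprime \<delta> (3 ^ \<beta>)"
    using d(2) prime_imp_coprime[of 3 \<delta>] by (simp add: coprime_commute)
  then show "\<delta> \<in> {\<delta>. \<delta> dvd n}" using d(1) by (simp add: coprime_dvd_mult_right_iff)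
qed (use assms in \<open>auto dest: dvd_trans\<close>)

section \<open>The eta coefficient as a signed count of mixed representations\<close>

lemma eps_minus: "eps (- x) = eps x"
proof -
  have "(- x) mod 8 = 1 \<longleftrightarrow> x mod 8 = 7" "(- x) mod 8 = 7 \<longleftrightarrow> x mod 8 = 1" by presburger+
  then show ?thesis by (auto simp: eps_def)
qed

lemma eps_add_8_mult: "eps (x + 8 * k) = eps x"
  by (simp add: eps_def)

lemma eps_add_4: "odd x \<Longrightarrow> eps (x + 4) = - eps x"
proof -
  assume "odd x"
  then have "(x + 4) mod 8 = 1 \<or> (x + 4) mod 8 = 7 \<longleftrightarrow> \<not> (x mod 8 = 1 \<or> x mod 8 = 7)" by presburger
  then show ?thesis by (simp add: eps_def)
qed

lemma eps_add_4_mult: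
  assumes "odd x"
  shows "eps (x + 4 * k) = (if even k then eps x else - eps x)"
proof (cases "even k")
  case True
  then obtain j where "k = 2 * j" by blast
  then show ?thesis using eps_add_8_mult[of x j] by simp
next
  case False
  then obtain j where "k = 2 * j + 1" by (rule oddE)
  then have "eps (x + 4 * k) = eps ((x + 4) + 8 * j)" by (simp add: algebra_simps)
  then show ?thesis using False eps_add_8_mult eps_add_4[OF assms] by simp
qed

lemma finite_odd_reps: "finite (odd_reps M)"
  by (rule finite_subset[OF _ finite_quad_reps[of "8 * int M"]]) (auto simp: odd_reps_def quad_reps_def)

text \<open>The four sign changes preserve the weight and fix no odd number, giving the factor
  2^4.\<close>

lemma sum_odd_reps_eq_eta:
  "(\<Sum>(x, y, z, w)\<in>odd_reps M. eps y * eps w) = 16 * eta_coeff M"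
proof -
  let ?g = "\<lambda>(x, y, z, w). eps y * eps w"
  define S1 where "S1 = {v \<in> odd_reps M. case v of (x, y, z, w) \<Rightarrow> x > 0}"
  define S2 where "S2 = {v \<in> S1. case v of (x, y, z, w) \<Rightarrow> y > 0}"
  define S3 where "S3 = {v \<in> S2. case v of (x, y, z, w) \<Rightarrow> z > 0}"
  define S4 where "S4 = {v \<in> S3. case v of (x, y, z, w) \<Rightarrow> w > 0}"
  have fin: "finite S1" "finite S2" "finite S3" by (simp_all add: S1_def S2_def S3_def finite_odd_reps)
  have pos: "- x > 0 \<longleftrightarrow> \<not> x > 0" if "odd x" for x :: int using that by presburger
  have "sum ?g (odd_reps M) = 2 * sum ?g S1" unfolding S1_def
    by (rule sum_eq_twice_half[OF finite_odd_reps, where f = "\<lambda>(x, y, z, w). (- x, y, z, w)"])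
      (auto simp: odd_reps_def eps_minus dest: pos)
  also have "sum ?g S1 = 2 * sum ?g S2" unfolding S2_def
    by (rule sum_eq_twice_half[OF fin(1), where f = "\<lambda>(x, y, z, w). (x, - y, z, w)"])
      (auto simp: S1_def odd_reps_def eps_minus dest: pos)
  also have "sum ?g S2 = 2 * sum ?g S3" unfolding S3_def
    by (rule sum_eq_twice_half[OF fin(2), where f = "\<lambda>(x, y, z, w). (x, y, - z, w)"])
      (auto simp: S1_def S2_def odd_reps_def eps_minus dest: pos)
  also have "sum ?g S3 = 2 * sum ?g S4" unfolding S4_def
    by (rule sum_eq_twice_half[OF fin(3), where f = "\<lambda>(x, y, z, w). (x, y, z, - w)"])
      (auto simp: S1_def S2_def S3_def odd_reps_def eps_minus dest: pos)
  also have "S4 = {(x, y, z, w) \<in> odd_reps M. x > 0 \<and> y > 0 \<and> z > 0 \<and> w > 0}"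
    by (auto simp: S1_def S2_def S3_def S4_def)
  finally show ?thesis unfolding eta_coeff_eq_sum_eps by simp
qed

text \<open>The substitution multiplies the form by 8, and its image consists of the odd
  representations satisfying three congruences. Each congruence selects one of two elements
  exchanged by a symmetry of \<open>g\<close>, giving the factor 2^3.\<close>

lemma sum_odd_reps_eq_mixed:
  fixes g :: "int \<times> int \<times> int \<times> int \<Rightarrow> int"
  assumes "odd M"
    and y: "\<And>x y z w. g (x, - y, z, w) = g (x, y, z, w)"
    and w: "\<And>x y z w. g (x, y, z, - w) = g (x, y, z, w)"
    and zw: "\<And>x y z w. g (x, y, w, z) = g (x, y, z, w)"
  shows "sum g (odd_reps M) =
    8 * (\<Sum>(a, p, r, c)\<in>mixed_reps (int M). g (2 * a + p + 3 * r, 2 * a - p - 3 * r, 2 * c + p - r, 2 * c - p + r))"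
proof -
  define S1 where "S1 = {v \<in> odd_reps M. case v of (x, y, z, w) \<Rightarrow> 4 dvd x + y}"
  define S2 where "S2 = {v \<in> S1. case v of (x, y, z, w) \<Rightarrow> 4 dvd z + w}"
  define S3 where "S3 = {v \<in> S2. case v of (x, y, z, w) \<Rightarrow> 8 dvd (x - y) - (z - w)}"
  have fin: "finite S1" "finite S2" by (simp_all add: S1_def S2_def finite_odd_reps)
  have tog: "4 dvd x - y \<longleftrightarrow> \<not> 4 dvd x + y" if "odd x" "odd y" for x y :: int using that by presburger
  have "sum g (odd_reps M) = 2 * sum g S1" unfolding S1_def
    by (rule sum_eq_twice_half[OF finite_odd_reps, where f = "\<lambda>(x, y, z, w). (x, - y, z, w)"])
      (auto simp: odd_reps_def y tog)
  also have "sum g S1 = 2 * sum g S2" unfolding S2_def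
    by (rule sum_eq_twice_half[OF fin(1), where f = "\<lambda>(x, y, z, w). (x, y, z, - w)"])
      (auto simp: S1_def odd_reps_def w tog)
  also have "sum g S2 = 2 * sum g S3" unfolding S3_def
  proof (rule sum_eq_twice_half[OF fin(2), where f = "\<lambda>(x, y, z, w). (x, y, w, z)"])
    fix v assume v: "v \<in> S2"
    obtain x y z w where vv: "v = (x, y, z, w)" by (cases v)
    have h: "odd x" "odd y" "odd z" "odd w" "4 dvd x + y" "4 dvd z + w"
      using v by (auto simp: vv S1_def S2_def odd_reps_def)
    \<comment> \<open>Both \<open>x - y\<close> and \<open>z - w\<close> are 2 modulo 4, so their
      sum and difference are multiples of 4 that differ by 4 modulo 8.\<close>
    have "8 dvd (x - y) - (w - z) \<longleftrightarrow> \<not> 8 dvd (x - y) - (z - w)"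
      using h by presburger
    then show "(case v of (x, y, z, w) \<Rightarrow> (x, y, w, z)) \<in> S2 \<and>
       (case (case v of (x, y, z, w) \<Rightarrow> (x, y, w, z)) of (x, y, z, w) \<Rightarrow> (x, y, w, z)) = v \<and>
       ((case (case v of (x, y, z, w) \<Rightarrow> (x, y, w, z)) of (x, y, z, w) \<Rightarrow> 8 dvd (x - y) - (z - w)) \<longleftrightarrow>
        \<not> (case v of (x, y, z, w) \<Rightarrow> 8 dvd (x - y) - (z - w))) \<and>
       g (case v of (x, y, z, w) \<Rightarrow> (x, y, w, z)) = g v"
      using v by (auto simp: vv S1_def S2_def odd_reps_def zw add_ac)
  qed
  also have "sum g S3 =
      (\<Sum>(a, p, r, c)\<in>mixed_reps (int M). g (2 * a + p + 3 * r, 2 * a - p - 3 * r, 2 * c + p - r, 2 * c - p + r))"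
  proof -
    have norm: "(2 * a + p + 3 * r)\<^sup>2 + (2 * a - p - 3 * r)\<^sup>2 + 3 * (2 * c + p - r)\<^sup>2 + 3 * (2 * c - p + r)\<^sup>2 =
        8 * (a\<^sup>2 + p\<^sup>2 + 3 * r\<^sup>2 + 3 * c\<^sup>2)" for a p r c :: int
      by (simp add: power2_eq_square algebra_simps)
    define i :: "int \<times> int \<times> int \<times> int \<Rightarrow> int \<times> int \<times> int \<times> int" where
      "i = (\<lambda>(a, p, r, c). (2 * a + p + 3 * r, 2 * a - p - 3 * r, 2 * c + p - r, 2 * c - p + r))"
    define j :: "int \<times> int \<times> int \<times> int \<Rightarrow> int \<times> int \<times> int \<times> int" where
      "j = (\<lambda>(x, y, z, w). ((x + y) div 4, (x - y + 3 * z - 3 * w) div 8, (x - y - z + w) div 8, (z + w) div 4))"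
    have ji: "j (i v) = v" for v by (cases v) (simp add: i_def j_def)
    have iS: "i v \<in> S3" if "v \<in> mixed_reps (int M)" for v
    proof -
      obtain a p r c where v: "v = (a, p, r, c)" by (cases v)
      have h: "odd (p + r)" "a\<^sup>2 + p\<^sup>2 + 3 * r\<^sup>2 + 3 * c\<^sup>2 = int M"
        using that by (auto simp: v mixed_reps_def quad_reps_def)
      have "odd (2 * a + p + 3 * r)" "odd (2 * a - p - 3 * r)" "odd (2 * c + p - r)" "odd (2 * c - p + r)"
        using h(1) by presburger+
      moreover have "(2 * a + p + 3 * r)\<^sup>2 + (2 * a - p - 3 * r)\<^sup>2 + 3 * (2 * c + p - r)\<^sup>2 + 3 * (2 * c - p + r)\<^sup>2 = 8 * int M"
        unfolding norm h(2) ..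
      ultimately have "i v \<in> odd_reps M" by (simp add: v i_def odd_reps_def)
      moreover have "4 dvd (2 * a + p + 3 * r) + (2 * a - p - 3 * r)" "4 dvd (2 * c + p - r) + (2 * c - p + r)"
        "8 dvd ((2 * a + p + 3 * r) - (2 * a - p - 3 * r)) - ((2 * c + p - r) - (2 * c - p + r))"
        by presburger+
      ultimately show ?thesis by (simp only: v i_def S1_def S2_def S3_def mem_Collect_eq prod.case simp_thms)
    qed
    have jS: "j v \<in> mixed_reps (int M) \<and> i (j v) = v" if "v \<in> S3" for v
    proof -
      obtain x y z w where v: "v = (x, y, z, w)" by (cases v)
      have h: "odd x" "odd y" "odd z" "odd w" "4 dvd x + y" "4 dvd z + w" "8 dvd (x - y) - (z - w)"
        "x\<^sup>2 + y\<^sup>2 + 3 * z\<^sup>2 + 3 * w\<^sup>2 = 8 * int M"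
        using that by (auto simp: v S1_def S2_def S3_def odd_reps_def)
      obtain a where a: "x + y = 4 * a" using h(5) by blast
      obtain c where c: "z + w = 4 * c" using h(6) by blast
      obtain r where r: "(x - y) - (z - w) = 8 * r" using h(7) by blast
      define p where "p = r + (2 * c - w)"
      have xyzw: "x = 2 * a + p + 3 * r" "y = 2 * a - p - 3 * r" "z = 2 * c + p - r" "w = 2 * c - p + r"
        using a c r unfolding p_def by linarith+
      have eq: "v = i (a, p, r, c)" by (simp add: v i_def xyzw)
      have "a\<^sup>2 + p\<^sup>2 + 3 * r\<^sup>2 + 3 * c\<^sup>2 = int M" using h(8) unfolding xyzw norm by simp
      moreover have "odd (p + r)" using h(1) unfolding xyzw by presburger
      moreover have "even (a + c)"
      proof -
        have "odd (a\<^sup>2 + p\<^sup>2 + 3 * r\<^sup>2 + 3 * c\<^sup>2)" using calculation(1) assms(1) by simp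
        then show ?thesis using \<open>odd (p + r)\<close> by auto
      qed
      ultimately have "(a, p, r, c) \<in> mixed_reps (int M)" by (simp add: mixed_reps_def quad_reps_def)
      then show ?thesis unfolding eq ji by simp
    qed
    have "sum g S3 = (\<Sum>v\<in>mixed_reps (int M). g (i v))"
      by (rule sum.reindex_bij_witness[where i = i and j = j]) (use iS jS ji in auto)
    then show ?thesis by (simp add: i_def case_prod_unfold)
  qed
  finally show ?thesis by simp
qed

text \<open>The symmetrized weight sums to \<open>32 * eta_coeff M\<close>. After the substitution
  it is 0 for odd \<open>c\<close> and 2 or -2 for even \<open>c\<close>, and the substitution
  contributes a factor 8.\<close>

lemma eta_coeff_eq_signed_count:
  assumes "M mod 8 = 3"
  shows "2 * eta_coeff M = (\<Sum>(a, p, r, c)\<in>{(a, p, r, c) \<in> mixed_reps (int M). even c}. if p mod 4 = 2 then 1 else -1)"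
proof -
  have M: "odd M" "int M mod 8 = 3" using assms by presburger+
  \<comment> \<open>The weight is symmetrized in \<open>z\<close> and \<open>w\<close>, since
    \<open>sum_odd_reps_eq_mixed\<close> requires that symmetry.\<close>
  define g where "g = (\<lambda>(x :: int, y, z, w). eps y * eps w + eps y * eps z)"
  have val: "g (2 * a + p + 3 * r, 2 * a - p - 3 * r, 2 * c + p - r, 2 * c - p + r) =
      (if even c then 2 * (if p mod 4 = 2 then 1 else -1) else 0)" if h: "(a, p, r, c) \<in> mixed_reps (int M)" for a p r c
  proof -
    have pr: "odd (p - r)" "odd (p + 3 * r)" using h by (auto simp: mixed_reps_def)
    have zz: "2 * c + p - r = (- (2 * c - p + r)) + 4 * c" by simp
    have ow: "odd (- (2 * c - p + r))" using pr by simp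
    have z: "eps (2 * c + p - r) = (if even c then eps (2 * c - p + r) else - eps (2 * c - p + r))"
      unfolding zz eps_add_4_mult[OF ow] eps_minus ..
    show ?thesis
    proof (cases "even c")
      case False
      then show ?thesis by (simp add: g_def z)
    next
      case True
      have par: "even a" "even p" "odd r" "4 dvd p \<longleftrightarrow> (4 dvd a \<longleftrightarrow> 4 dvd c)"
        using mixed_reps_even[OF h M(2) True] by auto
      obtain \<alpha> \<gamma> where ac: "a = 2 * \<alpha>" "c = 2 * \<gamma>" using par(1) True by blast
      have "2 * a - p - 3 * r = - ((p + 3 * r) + 4 * (- \<alpha>))" by (simp add: ac)
      then have y: "eps (2 * a - p - 3 * r) = (if even \<alpha> then eps (p + 3 * r) else - eps (p + 3 * r))"
        by (simp only: eps_minus eps_add_4_mult[OF pr(2)]) simp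
      have "2 * c - p + r = - ((p - r) + 4 * (- \<gamma>))" by (simp add: ac)
      then have w: "eps (2 * c - p + r) = (if even \<gamma> then eps (p - r) else - eps (p - r))"
        by (simp only: eps_minus eps_add_4_mult[OF pr(1)]) simp
      \<comment> \<open>The odd shift contributes one sign, so the product of the values at
        \<open>y\<close> and \<open>w\<close> is 1 exactly when \<open>\<alpha> + \<gamma>\<close>
        is odd, that is, when 4 does not divide \<open>p\<close>.\<close>
      have "p + 3 * r = (p - r) + 4 * r" by simp
      then have pr': "eps (p + 3 * r) = - eps (p - r)"
        using eps_add_4_mult[OF pr(1), of r] par(3) by (simp only: if_False)
      have "4 dvd p \<longleftrightarrow> (even \<alpha> \<longleftrightarrow> even \<gamma>)" using par(4) unfolding ac by presburger
      moreover have "p mod 4 = 2 \<longleftrightarrow> \<not> 4 dvd p" using par(2) by presburger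
      moreover have "eps x * eps x = 1" for x by (simp add: eps_def)
      ultimately show ?thesis using True by (simp add: g_def z y w pr')
    qed
  qed
  have swap: "(\<Sum>(x, y, z, w)\<in>odd_reps M. eps y * eps z) = (\<Sum>(x, y, z, w)\<in>odd_reps M. eps y * eps w)"
    by (rule sum.reindex_bij_witness[where i = "\<lambda>(x, y, z, w). (x, y, w, z)" and j = "\<lambda>(x, y, z, w). (x, y, w, z)"])
      (auto simp: odd_reps_def)
  have "sum g (odd_reps M) = (\<Sum>(x, y, z, w)\<in>odd_reps M. eps y * eps w) + (\<Sum>(x, y, z, w)\<in>odd_reps M. eps y * eps z)"
    by (simp add: g_def sum.distrib[symmetric] case_prod_unfold)
  also have "\<dots> = 32 * eta_coeff M" unfolding swap sum_odd_reps_eq_eta by simp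
  finally have 1: "sum g (odd_reps M) = 32 * eta_coeff M" .
  have "sum g (odd_reps M) =
    8 * (\<Sum>(a, p, r, c)\<in>mixed_reps (int M). g (2 * a + p + 3 * r, 2 * a - p - 3 * r, 2 * c + p - r, 2 * c - p + r))"
    by (rule sum_odd_reps_eq_mixed[OF M(1)]) (simp_all add: g_def eps_minus)
  also have "(\<Sum>(a, p, r, c)\<in>mixed_reps (int M). g (2 * a + p + 3 * r, 2 * a - p - 3 * r, 2 * c + p - r, 2 * c - p + r)) =
     (\<Sum>v\<in>mixed_reps (int M). if (case v of (a, p, r, c) \<Rightarrow> even c)
        then (case v of (a, p, r, c) \<Rightarrow> 2 * (if p mod 4 = 2 then 1 else -1)) else 0)"
  proof (rule sum.cong)
    fix v assume v: "v \<in> mixed_reps (int M)"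
    obtain a p r c where vv: "v = (a, p, r, c)" by (cases v)
    show "(case v of (a, p, r, c) \<Rightarrow> g (2 * a + p + 3 * r, 2 * a - p - 3 * r, 2 * c + p - r, 2 * c - p + r)) =
      (if (case v of (a, p, r, c) \<Rightarrow> even c) then (case v of (a, p, r, c) \<Rightarrow> 2 * (if p mod 4 = 2 then 1 else -1)) else 0)"
      using val[of a p r c] v unfolding vv prod.case by simp
  qed simp
  also have "\<dots> = (\<Sum>v\<in>{v \<in> mixed_reps (int M). case v of (a, p, r, c) \<Rightarrow> even c}.
      case v of (a, p, r, c) \<Rightarrow> 2 * (if p mod 4 = 2 then 1 else -1))"
    by (rule sum.inter_filter[symmetric, OF finite_mixed_reps])
  also have "\<dots> = 2 * (\<Sum>(a, p, r, c)\<in>{(a, p, r, c) \<in> mixed_reps (int M). even c}. if p mod 4 = 2 then 1 else -1)"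
    by (simp add: sum_distrib_left case_prod_unfold)
  finally show ?thesis using 1 by simp
qed

section \<open>Combining the three counts\<close>

theorem theorem4p7:
  fixes n n\<^sub>1 \<beta> :: nat
  assumes "n > 0"
    and "n\<^sub>1 > 0"
    and "8 * n + 11 = 3 ^ \<beta> * n\<^sub>1"
    and "\<not> 3 dvd n\<^sub>1"
  shows "int (tri_rep_count 1 3 3 4 n) = int (divisor_sigma n\<^sub>1) + eta_coeff (8 * n + 11)"
proof -
  define N where "N = 8 * n + 11"
  have N: "odd N" "N mod 8 = 3" "int N mod 8 = 3" "int N = 8 * int n + 11"
    unfolding N_def by presburger+
  define T where "T = {(a, p, r, c) \<in> mixed_reps (int N). odd c}"
  define S where "S = {(a, p, r, c) \<in> mixed_reps (int N). even c}"
  define U where "U = {(a, p, r, c) \<in> mixed_reps (int N). even c \<and> p mod 4 = 2}"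
  have fin: "finite S" "finite T"
    by (auto simp: S_def T_def intro: finite_subset[OF _ finite_mixed_reps[of "int N"]])
  have t: "tri_rep_count 1 3 3 4 n = card T"
    unfolding T_def N(4) by (rule tri_rep_count_eq_card_mixed_reps)
  have TU: "card T = 2 * card U"
    unfolding T_def U_def by (rule card_mixed_reps_odd[OF N(3)])
  have "{\<delta>. \<delta> dvd N \<and> \<not> 3 dvd \<delta>} = {\<delta>. \<delta> dvd n\<^sub>1}"
    unfolding N_def assms(3) by (rule divisors_prime_to_3[OF assms(2,4)])
  then have "int (card (quad_reps (int N))) = 4 * int (divisor_sigma n\<^sub>1)"
    using card_quad_reps[OF N(1)] by (simp add: divisor_sigma_def)
  moreover have "card (mixed_reps (int N)) = card S + card T"
    using fin by (subst card_Un_disjoint[symmetric]) (auto simp: S_def T_def intro!: arg_cong[where f = card])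
  moreover have "card (quad_reps (int N)) = 2 * card (mixed_reps (int N))"
    using N(1) by (intro card_mixed_reps) simp
  ultimately have ST: "int (card S) + int (card T) = 2 * int (divisor_sigma n\<^sub>1)" by simp
  have card_filter: "(\<Sum>v\<in>S. if P v then 1 else 0) = int (card {v \<in> S. P v})" for P
    using sum.inter_filter[OF fin(1), of "\<lambda>_. 1 :: int" P] by simp
  have "2 * eta_coeff N = (\<Sum>(a, p, r, c)\<in>S. if p mod 4 = 2 then 1 else -1)"
    unfolding S_def by (rule eta_coeff_eq_signed_count[OF N(2)])
  also have "\<dots> = (\<Sum>v\<in>S. 2 * (if (case v of (a, p, r, c) \<Rightarrow> p mod 4 = 2) then 1 else 0) - 1)"
    by (rule sum.cong) auto
  also have "\<dots> = 2 * (\<Sum>v\<in>S. if (case v of (a, p, r, c) \<Rightarrow> p mod 4 = 2) then 1 else 0) - int (card S)"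
    by (simp add: sum_subtractf sum_distrib_left)
  also have "(\<Sum>v\<in>S. if (case v of (a, p, r, c) \<Rightarrow> p mod 4 = 2) then 1 else 0) =
      int (card {v \<in> S. case v of (a, p, r, c) \<Rightarrow> p mod 4 = 2})"
    by (rule card_filter)
  also have "{v \<in> S. case v of (a, p, r, c) \<Rightarrow> p mod 4 = 2} = U"
    by (auto simp: S_def U_def)
  finally show ?thesis using ST TU unfolding t N_def[symmetric] by linarith
qed

end
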